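(* Let $R$ be a commutative ring, $n\ge1$, and let $A_1,\dots,A_{2n-1}\in M_{n\times n}(R)$. For all $1\le i,j\le n$ and any $s\in\{1,\dots,2n\}$ (the formula does not depend on which one), the $(i,j)$-th entry of the complete antisymmetrisation $[A_1,\dots,A_{2n-1}]=\sum_{\pi\in\Sigma_{2n-1}}\operatorname{sgn}(\pi)A_{\pi(1)}\cdots A_{\pi(2n-1)}$ is $$[A_1,\dots,A_{2n-1}]_{ij}=(-1)^{\binom n2+s-1}\sum_{\nu:\ \underline p(\nu)-\underline q(\nu)=\underline e_i-\underline e_j}\det(M_\nu^{\emptyset,s})\Bigl(\prod_{r=1}^{n}(\underline p(\nu)_r+\delta_{j,r}-1)!\Bigr)\det\bigl((A_r)_{ab}\bigr)_{1\le r\le 2n-1,\ (a,b)\in\nu},$$ where the sum is over types $\nu$ of rank $n$, and the factorial of a negative number is defined to be $1$.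
   Context: A type of rank $n$ is a subset $\nu\subset\{(a,b):1\le a,b\le n\}$ with $|\nu|=2n-1$; fix an ordering of the elements of each $\nu$ (e.g. lexicographic). Its weight vectors $\underline p(\nu),\underline q(\nu)\in\mathbb{Z}^n$ are $\underline p(\nu)_a=|\{b:(a,b)\in\nu\}|$ and $\underline q(\nu)_b=|\{a:(a,b)\in\nu\}|$. $\underline e_i$ is the $i$-th standard basis vector, $\delta$ is the Kronecker delta and $\Sigma_{N}$ the symmetric group on $N$ letters. $M_\nu$ is the $(2n-1)\times 2n$ matrix whose rows are indexed by the elements of $\nu$ in order; the row indexed by $(a,b)$ has a $-1$ in column $a$, a $1$ in column $n+b$, and zeros elsewhere. $M_\nu^{\emptyset,s}$ is the square matrix obtained by deleting column $s$. The last determinant is that of the $(2n-1)\times(2n-1)$ matrix with entry $(A_r)_{ab}$ in row $r$ and column $(a,b)\in\nu$, the columns being in the chosen order of $\nu$. *)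

theory Defs
  imports
    "Jordan_Normal_Form.Determinant"
    "Jordan_Normal_Form.DL_Submatrix"
begin

(* Indices start at 0 throughout, as is usual for the types mat and vec: rows, columns and matrix
   labels 1, ..., m become 0, ..., m - 1. In particular the 1-based column s of the mathematical
   formula is column s - 1 here, so its sign exponent "(n choose 2) + s - 1" becomes
   "(n choose 2) + s". *)

definition is_type :: "nat \<Rightarrow> (nat \<times> nat) set \<Rightarrow> bool" where
  "is_type n \<nu> \<longleftrightarrow> \<nu> \<subseteq> {..<n} \<times> {..<n} \<and> card \<nu> = 2 * n - 1"

definition weight_p :: "nat \<Rightarrow> (nat \<times> nat) set \<Rightarrow> int vec" where
  "weight_p n \<nu> = vec n (\<lambda>a. int (card {b. (a, b) \<in> \<nu>}))"

definition weight_q :: "nat \<Rightarrow> (nat \<times> nat) set \<Rightarrow> int vec" where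
  "weight_q n \<nu> = vec n (\<lambda>b. int (card {a. (a, b) \<in> \<nu>}))"

(* An ordering of the elements of a type is given as a duplicate-free list xs enumerating it;
   row k belongs to the pair xs ! k. *)
definition type_mat :: "nat \<Rightarrow> (nat \<times> nat) list \<Rightarrow> int mat" where
  "type_mat n xs = mat (2 * n - 1) (2 * n)
     (\<lambda>(k, c). if c = fst (xs ! k) then - 1 else if c = n + snd (xs ! k) then 1 else 0)"

definition type_mat_del :: "nat \<Rightarrow> (nat \<times> nat) list \<Rightarrow> nat \<Rightarrow> int mat" where
  "type_mat_del n xs s = submatrix (type_mat n xs) UNIV (- {s})"

definition entry_mat :: "nat \<Rightarrow> (nat \<Rightarrow> 'a mat) \<Rightarrow> (nat \<times> nat) list \<Rightarrow> 'a mat" where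
  "entry_mat n A xs = mat (2 * n - 1) (2 * n - 1) (\<lambda>(r, k). A r $$ (xs ! k))"

(* The product A (\<pi> 0) * ... * A (\<pi> (m - 1)) of n x n matrices, in this order. *)
definition perm_prod :: "nat \<Rightarrow> nat \<Rightarrow> (nat \<Rightarrow> 'a :: comm_ring_1 mat) \<Rightarrow> (nat \<Rightarrow> nat) \<Rightarrow> 'a mat" where
  "perm_prod n m A \<pi> = foldr (*) (map (\<lambda>k. A (\<pi> k)) [0..<m]) (1\<^sub>m n)"

(* The complete antisymmetrisation [A 0, ..., A (m - 1)]. The sum of matrices is taken entrywise
   because the type mat, which contains matrices of all sizes, is not an additive monoid. *)
definition antisymmetrisation :: "nat \<Rightarrow> nat \<Rightarrow> (nat \<Rightarrow> 'a :: comm_ring_1 mat) \<Rightarrow> 'a mat" where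
  "antisymmetrisation n m A = mat n n
     (\<lambda>(i, j). \<Sum>\<pi> | \<pi> permutes {0..<m}. signof \<pi> * perm_prod n m A \<pi> $$ (i, j))"

definition fact_int :: "int \<Rightarrow> int" where
  "fact_int z = (if z < 0 then 1 else fact (nat z))"

end

theory Submission
  imports Defs "HOL-Computational_Algebra.Formal_Power_Series" "HOL-Combinatorics.Multiset_Permutations"
begin

text \<open>Read a pair \<open>(a, b)\<close> as an edge from \<open>a\<close> to \<open>b\<close> in a digraph on \<open>n\<close> vertices. Expanding the matrix
products over walks shows that the \<open>(i, j)\<close>-entry of the antisymmetrisation is the sum, over edge sets \<open>\<nu>\<close> of
size \<open>2 n - 1\<close>, of \<open>det (entry_mat n A (ord \<nu>))\<close> times the number of Eulerian trails of \<open>\<nu>\<close> from \<open>i\<close> to \<open>j\<close>,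
each counted with the sign of the order in which it runs through the edges
(\<open>antisymmetrisation_entry_types\<close>). It remains to evaluate this integer, which is done by
\<open>signed_trail_count\<close>.

Let \<open>\<theta>\<close> be anticommuting variables, one for every edge of \<open>\<nu>\<close>, and let \<open>\<Theta>\<close> be the \<open>n \<times> n\<close> matrix whose entry
\<open>(a, b)\<close> is the variable of that edge, or \<open>0\<close>. The signed number of trails is the coefficient of the product of
all variables in the entry \<open>(i, j)\<close> of \<open>\<Theta> ^ (2 n - 1) = \<Theta> (\<Theta>\<^sup>2) ^ (n - 1)\<close>. As in Rosset's proof of the
Amitsur-Levitzki theorem, \<open>\<Theta>\<^sup>2\<close> has commuting entries and all its powers have trace zero. Therefore
\<open>(\<Theta>\<^sup>2) ^ (n - 1)\<close> is the adjugate of \<open>- \<Theta>\<^sup>2\<close> (\<open>odd_matrix_even_power_cofactor\<close>), a sum over permutations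
\<open>\<sigma>\<close> of products of entries \<open>- \<Theta>\<^sup>2(a, \<sigma> a)\<close>, \<open>a \<noteq> j\<close>.

Choose a middle vertex \<open>f a\<close> in each of these entries. Together with the first factor \<open>\<Theta>(i, \<sigma> j)\<close> every term
consists of one edge out of every vertex except \<open>j\<close> and one edge into every vertex. Sorting the edges in this
way produces the sign \<open>(- 1) ^ ((n choose 2) + j)\<close> and absorbs the sign of \<open>\<sigma>\<close>. A selection of edges
out of the vertices and into the vertices that exhausts \<open>\<nu>\<close> arises from \<open>\<sigma>\<close> in exactly
\<open>\<Prod>r. (p\<^sub>r + \<delta>\<^sub>j\<^sub>r - 1)!\<close> ways (\<open>sum_over_permutations\<close>), and the sum over all selections is the top
coefficient of a product of linear forms whose coefficient vectors are the columns of \<open>type_mat\<close> other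
than \<open>j\<close>, hence the determinant of the matrix with column \<open>j\<close> deleted (\<open>sum_of_products_eq_det\<close>).\<close>

section \<open>The Grassmann algebra over the integers\<close>

text \<open>An element is given by its coefficients: \<open>f S\<close> belongs to the product of the generators
\<open>\<theta>\<^sub>k\<close>, \<open>k \<in> S\<close>, taken in increasing order. Infinitely many coefficients may be nonzero, since every
coefficient of a product is still a finite sum; only products of infinitely many generators have to be
excluded.\<close>

typedef grassmann = "{f :: nat set \<Rightarrow> int. \<forall>S. infinite S \<longrightarrow> f S = 0}"
  morphisms gcoeff Abs_grassmann
  by (rule exI[of _ "\<lambda>_. 0"]) simp

setup_lifting type_definition_grassmann

text \<open>The sign of the permutation that sorts the concatenation of the increasing enumerations of \<open>T\<close>
and \<open>U\<close>.\<close>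

definition shuffle_sign :: "nat set \<Rightarrow> nat set \<Rightarrow> int" where
  "shuffle_sign T U = (- 1) ^ card {(t, u). t \<in> T \<and> u \<in> U \<and> u < t}"

lemma finite_inversions:
  assumes "finite T" "finite U"
  shows "finite {(t, u). t \<in> T \<and> u \<in> U \<and> u < (t :: nat)}"
  by (rule finite_subset[of _ "T \<times> U"]) (use assms in auto)

lemma shuffle_sign_union_left:
  assumes "finite T" "finite U" "finite W" "T \<inter> U = {}"
  shows "shuffle_sign (T \<union> U) W = shuffle_sign T W * shuffle_sign U W"
proof -
  have eq: "{(t, u). t \<in> T \<union> U \<and> u \<in> W \<and> u < t} =
      {(t, u). t \<in> T \<and> u \<in> W \<and> u < t} \<union> {(t, u). t \<in> U \<and> u \<in> W \<and> u < t}"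
    by auto
  show ?thesis
    unfolding shuffle_sign_def eq
    by (subst card_Un_disjoint) (use assms finite_inversions in \<open>auto simp: power_add\<close>)
qed

lemma shuffle_sign_union_right:
  assumes "finite T" "finite U" "finite W" "U \<inter> W = {}"
  shows "shuffle_sign T (U \<union> W) = shuffle_sign T U * shuffle_sign T W"
proof -
  have eq: "{(t, u). t \<in> T \<and> u \<in> U \<union> W \<and> u < t} =
      {(t, u). t \<in> T \<and> u \<in> U \<and> u < t} \<union> {(t, u). t \<in> T \<and> u \<in> W \<and> u < t}"
    by auto
  show ?thesis
    unfolding shuffle_sign_def eq
    by (subst card_Un_disjoint) (use assms finite_inversions in \<open>auto simp: power_add\<close>)
qed

text \<open>Every pair in \<open>T \<times> U\<close> is an inversion for exactly one of the two orders of concatenation.\<close>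

lemma shuffle_sign_swap:
  assumes "finite T" "finite U" "T \<inter> U = {}"
  shows "shuffle_sign U T = (- 1) ^ (card T * card U) * shuffle_sign T U"
proof -
  have eq: "T \<times> U = {(t, u). t \<in> T \<and> u \<in> U \<and> u < t} \<union> prod.swap ` {(u, t). u \<in> U \<and> t \<in> T \<and> t < u}"
    using assms(3) by (auto simp: image_iff)
  have "card T * card U = card {(t, u). t \<in> T \<and> u \<in> U \<and> u < t} + card {(u, t). u \<in> U \<and> t \<in> T \<and> t < u}"
    unfolding card_cartesian_product[symmetric] eq
    by (subst card_Un_disjoint)
      (use assms finite_inversions in \<open>auto simp: card_image\<close>)
  then show ?thesis
    by (simp add: shuffle_sign_def power_add)
qed

lemma shuffle_sign_empty [simp]: "shuffle_sign {} U = 1" "shuffle_sign T {} = 1"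
  by (simp_all add: shuffle_sign_def)

instantiation grassmann :: ring_1
begin

lift_definition zero_grassmann :: grassmann is "\<lambda>S. 0" by simp

lift_definition one_grassmann :: grassmann is "\<lambda>S. if S = {} then 1 else 0" by auto

lift_definition plus_grassmann :: "grassmann \<Rightarrow> grassmann \<Rightarrow> grassmann" is "\<lambda>f g S. f S + g S" by simp

lift_definition uminus_grassmann :: "grassmann \<Rightarrow> grassmann" is "\<lambda>f S. - f S" by simp

lift_definition minus_grassmann :: "grassmann \<Rightarrow> grassmann \<Rightarrow> grassmann" is "\<lambda>f g S. f S - g S" by simp

lift_definition times_grassmann :: "grassmann \<Rightarrow> grassmann \<Rightarrow> grassmann" is
  "\<lambda>f g S. \<Sum>T\<in>Pow S. shuffle_sign T (S - T) * f T * g (S - T)"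
  by simp

instance
proof
  fix a b c :: grassmann
  show "a + b + c = a + (b + c)" "a + b = b + a" "0 + a = a" "- a + a = 0" "a - b = a + - b"
    by (transfer; simp add: algebra_simps)+
  show "(0 :: grassmann) \<noteq> 1"
    by transfer (auto simp: fun_eq_iff)
  show "(a + b) * c = a * c + b * c" "a * (b + c) = a * b + a * c"
    by (transfer; simp add: algebra_simps sum.distrib)+
  show "1 * a = a"
  proof (transfer, rule ext)
    fix f :: "nat set \<Rightarrow> int" and S :: "nat set"
    assume f: "\<forall>S. infinite S \<longrightarrow> f S = 0"
    show "(\<Sum>T\<in>Pow S. shuffle_sign T (S - T) * (if T = {} then 1 else 0) * f (S - T)) = f S"
    proof (cases "finite S")
      case True
      then have "(\<Sum>T\<in>Pow S. shuffle_sign T (S - T) * (if T = {} then 1 else 0) * f (S - T))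
          = (\<Sum>T\<in>Pow S. if T = {} then f S else 0)"
        by (intro sum.cong) auto
      then show ?thesis using True by simp
    qed (use f in simp)
  qed
  show "a * 1 = a"
  proof (transfer, rule ext)
    fix f :: "nat set \<Rightarrow> int" and S :: "nat set"
    assume f: "\<forall>S. infinite S \<longrightarrow> f S = 0"
    show "(\<Sum>T\<in>Pow S. shuffle_sign T (S - T) * f T * (if S - T = {} then 1 else 0)) = f S"
    proof (cases "finite S")
      case True
      then have "(\<Sum>T\<in>Pow S. shuffle_sign T (S - T) * f T * (if S - T = {} then 1 else 0))
          = (\<Sum>T\<in>Pow S. if T = S then f S else 0)"
        by (intro sum.cong) auto
      then show ?thesis using True by simp
    qed (use f in simp)
  qed
  show "a * b * c = a * (b * c)"
  proof (transfer, rule ext)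
    fix f g h :: "nat set \<Rightarrow> int" and S :: "nat set"
    show "(\<Sum>V\<in>Pow S. shuffle_sign V (S - V) *
          (\<Sum>T\<in>Pow V. shuffle_sign T (V - T) * f T * g (V - T)) * h (S - V)) =
        (\<Sum>T\<in>Pow S. shuffle_sign T (S - T) * f T *
          (\<Sum>U\<in>Pow (S - T). shuffle_sign U (S - T - U) * g U * h (S - T - U)))"
      (is "?lhs = ?rhs")
    proof (cases "finite S")
      case S: True
      have fin: "finite T" if "T \<subseteq> S" for T
        using S that by (rule rev_finite_subset)
      \<comment> \<open>Both sides sum over the decompositions \<open>S = T \<union> U \<union> W\<close>, with \<open>V = T \<union> U\<close>; the two signs
        agree because \<open>shuffle_sign\<close> is multiplicative in each argument.\<close>
      have "?lhs = (\<Sum>(V, T)\<in>(SIGMA V:Pow S. Pow V).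
          shuffle_sign V (S - V) * (shuffle_sign T (V - T) * f T * g (V - T)) * h (S - V))"
        by (subst sum.Sigma[symmetric])
          (use S in \<open>auto intro: fin simp: sum_distrib_left sum_distrib_right\<close>)
      also have "\<dots> = (\<Sum>(T, U)\<in>(SIGMA T:Pow S. Pow (S - T)).
          shuffle_sign T (S - T) * f T * (shuffle_sign U (S - T - U) * g U * h (S - T - U)))"
      proof (rule sum.reindex_bij_witness[of _ "\<lambda>(T, U). (T \<union> U, T)" "\<lambda>(V, T). (T, V - T)"])
        fix p assume "p \<in> (SIGMA V:Pow S. Pow V)"
        then obtain V T where p: "p = (V, T)" "T \<subseteq> V" "V \<subseteq> S" by auto
        define U W where "U = V - T" and "W = S - V"
        have sets: "V = T \<union> U" "S - T = U \<union> W" "S - T - U = W" "T \<inter> U = {}" "U \<inter> W = {}"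
          using p by (auto simp: U_def W_def)
        have finTUW: "finite T" "finite U" "finite W"
          using p by (auto simp: U_def W_def intro: fin)
        have "shuffle_sign V W * shuffle_sign T U = shuffle_sign T (S - T) * shuffle_sign U W"
          unfolding sets(1,2)
          by (simp add: shuffle_sign_union_left shuffle_sign_union_right finTUW sets)
        then show "(case case p of (V, T) \<Rightarrow> (T, V - T) of (T, U) \<Rightarrow>
            shuffle_sign T (S - T) * f T * (shuffle_sign U (S - T - U) * g U * h (S - T - U))) =
          (case p of (V, T) \<Rightarrow>
            shuffle_sign V (S - V) * (shuffle_sign T (V - T) * f T * g (V - T)) * h (S - V))"
          unfolding p(1) prod.case U_def[symmetric] sets(3) W_def[symmetric]
          by (simp add: mult_ac)
      qed auto
      also have "\<dots> = ?rhs"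
        by (subst sum.Sigma[symmetric])
          (use S in \<open>auto intro: fin simp: sum_distrib_left sum_distrib_right\<close>)
      finally show ?thesis .
    qed simp
  qed
qed

end

lemma gcoeff_sum: "gcoeff (sum f I) S = (\<Sum>i\<in>I. gcoeff (f i) S)"
  by (induction I rule: infinite_finite_induct)
    (simp_all add: zero_grassmann.rep_eq plus_grassmann.rep_eq)

lemma gcoeff_of_int_mult: "gcoeff (of_int z * x) S = z * gcoeff x S"
proof -
  have nat: "gcoeff (of_nat k * x) S = int k * gcoeff x S" for k
    by (induction k)
      (simp_all add: zero_grassmann.rep_eq plus_grassmann.rep_eq algebra_simps)
  show ?thesis
    by (cases z rule: int_cases2) (simp_all add: nat uminus_grassmann.rep_eq)
qed

text \<open>The \<open>\<int>/2\<close>-grading: the value \<open>True\<close> of the first argument stands for the even part and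
\<open>False\<close> for the odd part, so that the parity of a product is given by the equality of the two parities.\<close>

definition homogeneous_parity :: "bool \<Rightarrow> grassmann \<Rightarrow> bool" where
  "homogeneous_parity b x \<longleftrightarrow> (\<forall>S. even (card S) \<noteq> b \<longrightarrow> gcoeff x S = 0)"

abbreviation odd_grassmann :: "grassmann \<Rightarrow> bool" where
  "odd_grassmann \<equiv> homogeneous_parity False"

lemma homogeneous_parity_zero [simp]: "homogeneous_parity b 0"
  and homogeneous_parity_one [simp]: "homogeneous_parity True 1"
  and homogeneous_parity_add: "homogeneous_parity b x \<Longrightarrow> homogeneous_parity b y \<Longrightarrow> homogeneous_parity b (x + y)"
  and homogeneous_parity_minus: "homogeneous_parity b x \<Longrightarrow> homogeneous_parity b (- x)"
  by (auto simp: homogeneous_parity_def zero_grassmann.rep_eq one_grassmann.rep_eq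
      plus_grassmann.rep_eq uminus_grassmann.rep_eq split: if_splits)

lemma homogeneous_parity_diff:
  "homogeneous_parity b x \<Longrightarrow> homogeneous_parity b y \<Longrightarrow> homogeneous_parity b (x - y)"
  using homogeneous_parity_add[OF _ homogeneous_parity_minus] by fastforce

lemma homogeneous_parity_sum:
  "(\<And>i. i \<in> I \<Longrightarrow> homogeneous_parity b (f i)) \<Longrightarrow> homogeneous_parity b (sum f I)"
  by (induction I rule: infinite_finite_induct) (auto intro: homogeneous_parity_add)

lemma homogeneous_parity_mult:
  assumes "homogeneous_parity b x" "homogeneous_parity c y"
  shows "homogeneous_parity (b = c) (x * y)"
  unfolding homogeneous_parity_def
proof (intro allI impI)
  fix S :: "nat set" assume S: "even (card S) \<noteq> (b = c)"
  show "gcoeff (x * y) S = 0"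
  proof (cases "finite S")
    case True
    show ?thesis
      unfolding times_grassmann.rep_eq
    proof (intro sum.neutral ballI)
      fix T assume "T \<in> Pow S"
      then have "card S = card T + card (S - T)"
        using True by (simp add: card_Diff_subset card_mono finite_subset)
      then have "even (card T) \<noteq> b \<or> even (card (S - T)) \<noteq> c"
        using S by auto
      then show "shuffle_sign T (S - T) * gcoeff x T * gcoeff y (S - T) = 0"
        using assms by (auto simp: homogeneous_parity_def)
    qed
  qed (simp add: times_grassmann.rep_eq)
qed

text \<open>Supercommutativity: by \<open>shuffle_sign_swap\<close> exchanging monomials of degrees \<open>p\<close> and \<open>q\<close>
costs the sign \<open>(- 1) ^ (p * q)\<close>.\<close>

lemma homogeneous_commute:
  assumes "homogeneous_parity b x" "homogeneous_parity c y"
  shows "y * x = (if b \<or> c then x * y else - (x * y))"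
proof -
  define z :: int where "z = (if b \<or> c then 1 else - 1)"
  have "gcoeff (y * x) S = z * gcoeff (x * y) S" for S
  proof (cases "finite S")
    case True
    have "gcoeff (y * x) S = (\<Sum>T\<in>Pow S. shuffle_sign T (S - T) * gcoeff y T * gcoeff x (S - T))"
      by (simp add: times_grassmann.rep_eq)
    also have "\<dots> = (\<Sum>T\<in>Pow S. shuffle_sign (S - T) T * gcoeff y (S - T) * gcoeff x T)"
      by (rule sum.reindex_bij_witness[of _ "\<lambda>T. S - T" "\<lambda>T. S - T"]) (auto simp: double_diff)
    also have "\<dots> = (\<Sum>T\<in>Pow S. z * (shuffle_sign T (S - T) * gcoeff x T * gcoeff y (S - T)))"
    proof (rule sum.cong[OF refl])
      fix T assume "T \<in> Pow S"
      then have fin: "finite T" "finite (S - T)"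
        using True by (auto intro: finite_subset)
      have "shuffle_sign (S - T) T = (- 1) ^ (card T * card (S - T)) * shuffle_sign T (S - T)"
        by (rule shuffle_sign_swap) (use fin in auto)
      moreover have "(- 1) ^ (card T * card (S - T)) = z"
        if "gcoeff x T \<noteq> 0" "gcoeff y (S - T) \<noteq> 0"
      proof -
        have "even (card T) = b" "even (card (S - T)) = c"
          using that assms by (auto simp: homogeneous_parity_def)
        then show ?thesis by (auto simp: z_def)
      qed
      ultimately show "shuffle_sign (S - T) T * gcoeff y (S - T) * gcoeff x T =
          z * (shuffle_sign T (S - T) * gcoeff x T * gcoeff y (S - T))"
        by (cases "gcoeff x T = 0 \<or> gcoeff y (S - T) = 0") auto
    qed
    also have "\<dots> = z * gcoeff (x * y) S"
      by (simp add: times_grassmann.rep_eq sum_distrib_left)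
    finally show ?thesis .
  qed (simp add: times_grassmann.rep_eq)
  then have "gcoeff (y * x) = gcoeff (if b \<or> c then x * y else - (x * y))"
    by (auto simp: z_def uminus_grassmann.rep_eq)
  then show ?thesis
    by (simp only: gcoeff_inject)
qed

lemma grassmann_torsion_free:
  assumes "of_nat (Suc k) * (x :: grassmann) = 0"
  shows "x = 0"
proof -
  have "gcoeff (of_int (int (Suc k)) * x) S = 0" for S
    using assms by (simp add: zero_grassmann.rep_eq)
  then have "gcoeff x S = 0" for S
    unfolding gcoeff_of_int_mult by simp
  then have "gcoeff x = gcoeff 0"
    by (auto simp: zero_grassmann.rep_eq)
  then show ?thesis by (simp only: gcoeff_inject)
qed

text \<open>The even part is commutative. As a type of its own it carries determinants and power series.\<close>

typedef even_grassmann = "{x. homogeneous_parity True x}"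
  morphisms of_even Abs_even_grassmann
  by (rule exI[of _ 0]) simp

setup_lifting type_definition_even_grassmann

instantiation even_grassmann :: comm_ring_1
begin

lift_definition zero_even_grassmann :: even_grassmann is 0 by simp
lift_definition one_even_grassmann :: even_grassmann is 1 by simp
lift_definition plus_even_grassmann :: "even_grassmann \<Rightarrow> even_grassmann \<Rightarrow> even_grassmann" is "(+)"
  by (rule homogeneous_parity_add)
lift_definition uminus_even_grassmann :: "even_grassmann \<Rightarrow> even_grassmann" is uminus
  by (rule homogeneous_parity_minus)
lift_definition minus_even_grassmann :: "even_grassmann \<Rightarrow> even_grassmann \<Rightarrow> even_grassmann" is "(-)"
  by (rule homogeneous_parity_diff)
lift_definition times_even_grassmann :: "even_grassmann \<Rightarrow> even_grassmann \<Rightarrow> even_grassmann" is "(*)"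
  by (drule (1) homogeneous_parity_mult) simp

instance
proof
  fix a b c :: even_grassmann
  show "a * b = b * a"
    by transfer (drule (1) homogeneous_commute, simp)
  show "a * b * c = a * (b * c)" by transfer (rule mult.assoc)
  show "1 * a = a" by transfer (rule mult_1_left)
  show "a + b + c = a + (b + c)" by transfer (rule add.assoc)
  show "a + b = b + a" by transfer (rule add.commute)
  show "0 + a = a" by transfer (rule add_0)
  show "- a + a = 0" by transfer (rule left_minus)
  show "a - b = a + - b" by transfer (rule diff_conv_add_uminus)
  show "(a + b) * c = a * c + b * c" by transfer (rule distrib_right)
  show "(0 :: even_grassmann) \<noteq> 1"
    by transfer simp
qed

end

lemma of_even_sum: "of_even (sum f I) = (\<Sum>i\<in>I. of_even (f i))"
  by (induction I rule: infinite_finite_induct)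
    (simp_all add: zero_even_grassmann.rep_eq plus_even_grassmann.rep_eq)

lemma of_even_prod_list: "of_even (prod_list xs) = prod_list (map of_even xs)"
  by (induction xs) (simp_all add: one_even_grassmann.rep_eq times_even_grassmann.rep_eq)

lemma of_even_of_int: "of_even (of_int z) = of_int z"
proof -
  have nat: "of_even (of_nat k) = of_nat k" for k
    by (induction k)
      (simp_all add: zero_even_grassmann.rep_eq plus_even_grassmann.rep_eq one_even_grassmann.rep_eq)
  show ?thesis
    by (cases z rule: int_cases2) (simp_all add: nat uminus_even_grassmann.rep_eq)
qed

lemma even_grassmann_torsion_free:
  assumes "of_nat (Suc k) * (x :: even_grassmann) = 0"
  shows "x = 0"
proof -
  have "of_nat (Suc k) * of_even x = 0"
    using arg_cong[OF assms, of of_even] of_even_of_int[of "int (Suc k)"]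
    by (simp add: times_even_grassmann.rep_eq zero_even_grassmann.rep_eq)
  from grassmann_torsion_free[OF this] show ?thesis
    by transfer
qed

text \<open>The element \<open>\<Sum>k. c k * \<theta>\<^sub>k\<close>, a homogeneous element of degree one.\<close>

lift_definition linear_form :: "(nat \<Rightarrow> int) \<Rightarrow> grassmann" is
  "\<lambda>c S. if card S = 1 then c (the_elem S) else 0"
  by auto

lemma odd_linear_form [simp]: "odd_grassmann (linear_form c)"
  by (simp add: homogeneous_parity_def linear_form.rep_eq)

lemma linear_form_sum: "(\<Sum>i\<in>I. linear_form (f i)) = linear_form (\<lambda>k. \<Sum>i\<in>I. f i k)"
proof -
  have "gcoeff (\<Sum>i\<in>I. linear_form (f i)) = gcoeff (linear_form (\<lambda>k. \<Sum>i\<in>I. f i k))"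
    by (rule ext) (simp add: gcoeff_sum linear_form.rep_eq)
  then show ?thesis by (simp only: gcoeff_inject)
qed

lemma linear_form_uminus: "- linear_form f = linear_form (\<lambda>k. - f k)"
  by transfer auto

lemma gcoeff_linear_form_mult:
  assumes "finite S"
  shows "gcoeff (linear_form c * x) S =
    (\<Sum>s\<in>S. (- 1) ^ card {t \<in> S. t < s} * c s * gcoeff x (S - {s}))"
proof -
  have "gcoeff (linear_form c * x) S = (\<Sum>T\<in>(\<lambda>s. {s}) ` S.
      shuffle_sign T (S - T) * gcoeff (linear_form c) T * gcoeff x (S - T))"
    unfolding times_grassmann.rep_eq
    by (rule sum.mono_neutral_right)
      (use assms in \<open>auto simp: linear_form.rep_eq card_1_singleton_iff split: if_splits\<close>)
  also have "\<dots> = (\<Sum>s\<in>S. shuffle_sign {s} (S - {s}) * c s * gcoeff x (S - {s}))"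
    by (subst sum.reindex) (auto simp: linear_form.rep_eq)
  also have "\<dots> = (\<Sum>s\<in>S. (- 1) ^ card {t \<in> S. t < s} * c s * gcoeff x (S - {s}))"
  proof (rule sum.cong[OF refl])
    fix s assume "s \<in> S"
    have "{(t, u). t \<in> {s} \<and> u \<in> S - {s} \<and> u < t} = Pair s ` {t \<in> S. t < s}"
      by auto
    then have "shuffle_sign {s} (S - {s}) = (- 1) ^ card {t \<in> S. t < s}"
      by (simp add: shuffle_sign_def card_image inj_on_def)
    then show "shuffle_sign {s} (S - {s}) * c s * gcoeff x (S - {s}) =
        (- 1) ^ card {t \<in> S. t < s} * c s * gcoeff x (S - {s})"
      by simp
  qed
  finally show ?thesis .
qed

text \<open>The defining property of the exterior algebra: the coefficients of a product of linear forms
are the minors of their coefficient matrix. Multiplying by one more form from the left is the Laplace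
expansion along the first column.\<close>

lemma gcoeff_prod_linear_forms:
  assumes "sorted L" "distinct L" "length L = length cs"
  shows "gcoeff (prod_list (map linear_form cs)) (set L) =
    det (mat (length cs) (length cs) (\<lambda>(r, k). (cs ! k) (L ! r)))"
  using assms
proof (induction cs arbitrary: L)
  case Nil
  then show ?case by (simp add: one_grassmann.rep_eq)
next
  case (Cons c cs)
  define m where "m = length cs"
  define C where "C = mat (Suc m) (Suc m) (\<lambda>(r, k). ((c # cs) ! k) (L ! r))"
  have len: "length L = Suc m" using Cons.prems by (simp add: m_def)
  have strict: "L ! p < L ! q \<longleftrightarrow> p < q" if "p < Suc m" "q < Suc m" for p q
    using that Cons.prems len sorted_nth_mono[of L] nth_eq_iff_index_eq[of L]
    by (metis leD le_less_linear le_neq_implies_less less_imp_le_nat nat_less_le)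
  have "gcoeff (prod_list (map linear_form (c # cs))) (set L) =
     (\<Sum>s\<in>set L. (- 1) ^ card {t \<in> set L. t < s} * c s *
       gcoeff (prod_list (map linear_form cs)) (set L - {s}))"
    by (simp add: gcoeff_linear_form_mult)
  also have "\<dots> = (\<Sum>r<Suc m. (- 1) ^ card {t \<in> set L. t < L ! r} * c (L ! r) *
       gcoeff (prod_list (map linear_form cs)) (set L - {L ! r}))"
    by (rule sum.reindex_bij_betw[symmetric])
      (use Cons.prems len in \<open>simp add: bij_betw_nth lessThan_atLeast0\<close>)
  also have "\<dots> = (\<Sum>r<Suc m. C $$ (r, 0) * cofactor C r 0)"
  proof (rule sum.cong[OF refl])
    fix r assume "r \<in> {..<Suc m}"
    then have r: "r < Suc m" by simp
    have "{t \<in> set L. t < L ! r} = (!) L ` {..<r}"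
      using r len by (fastforce simp: set_conv_nth strict image_iff)
    moreover have "inj_on ((!) L) {..<r}"
      using r len Cons.prems by (intro inj_on_nth) auto
    ultimately have card: "card {t \<in> set L. t < L ! r} = r"
      by (simp add: card_image)
    define L' where "L' = take r L @ drop (Suc r) L"
    have nthL': "L' ! q = L ! (if q < r then q else Suc q)" if "q < m" for q
      using that r len by (auto simp: L'_def nth_append)
    have split: "L = take r L @ L ! r # drop (Suc r) L"
      using r len by (simp add: id_take_nth_drop)
    have "distinct (take r L @ L ! r # drop (Suc r) L)" "sorted (take r L @ L ! r # drop (Suc r) L)"
        "set L = set (take r L @ L ! r # drop (Suc r) L)"
      unfolding split[symmetric] using Cons.prems(1,2) by simp_all
    then have setL': "set L - {L ! r} = set L'" and L': "sorted L'" "distinct L'"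
      unfolding L'_def by (auto simp: sorted_append)
    have L'_length: "length L' = length cs"
      using r len by (simp add: L'_def m_def)
    have minor: "mat_delete C r 0 = mat m m (\<lambda>(r, k). (cs ! k) (L' ! r))"
      by (rule eq_matI) (auto simp: mat_delete_def C_def nthL')
    have "gcoeff (prod_list (map linear_form cs)) (set L - {L ! r}) = det (mat_delete C r 0)"
      unfolding setL' Cons.IH[OF L' L'_length] minor by (simp add: m_def)
    then show "(- 1) ^ card {t \<in> set L. t < L ! r} * c (L ! r) *
       gcoeff (prod_list (map linear_form cs)) (set L - {L ! r}) = C $$ (r, 0) * cofactor C r 0"
      using r by (simp add: card cofactor_def C_def)
  qed
  also have "\<dots> = det C"
    by (rule laplace_expansion_column[symmetric]) (auto simp: C_def)
  finally show ?case by (simp add: C_def m_def)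
qed

corollary gcoeff_prod_linear_forms_top:
  assumes "length cs = m"
  shows "gcoeff (prod_list (map linear_form cs)) {..<m} = det (mat m m (\<lambda>(r, k). (cs ! k) r))"
proof -
  have "{..<m} = set [0..<m]" by auto
  then have "gcoeff (prod_list (map linear_form cs)) {..<m} =
      det (mat m m (\<lambda>(r, k). (cs ! k) ([0..<m] ! r)))"
    using gcoeff_prod_linear_forms[of "[0..<m]" cs] assms by simp
  also have "mat m m (\<lambda>(r, k). (cs ! k) ([0..<m] ! r)) = mat m m (\<lambda>(r, k). (cs ! k) r)"
    by (rule eq_matI) auto
  finally show ?thesis .
qed

section \<open>Matrices whose powers have trace zero\<close>

definition replace_row :: "'a mat \<Rightarrow> nat \<Rightarrow> (nat \<Rightarrow> 'a) \<Rightarrow> 'a mat" where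
  "replace_row A j v = mat (dim_row A) (dim_col A) (\<lambda>(a, b). if a = j then v b else A $$ (a, b))"

lemma det_replace_row_cofactor:
  fixes A :: "'a :: comm_ring_1 mat"
  assumes A: "A \<in> carrier_mat n n" and j: "j < n"
  shows "det (replace_row A j v) = (\<Sum>k<n. v k * cofactor A j k)"
proof -
  have "mat_delete (replace_row A j v) j k = mat_delete A j k" for k
    using A by (intro eq_matI) (auto simp: mat_delete_def replace_row_def)
  moreover have "replace_row A j v \<in> carrier_mat n n"
    using A by (simp add: replace_row_def)
  ultimately show ?thesis
    using A j by (subst laplace_expansion_row[of _ n j]) (auto simp: cofactor_def replace_row_def)
qed

lemma det_replace_row_permutations:
  fixes A :: "'a :: comm_ring_1 mat"
  assumes A: "A \<in> carrier_mat n n" and j: "j < n"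
  shows "det (replace_row A j v) =
    (\<Sum>\<sigma> | \<sigma> permutes {0..<n}. signof \<sigma> * (v (\<sigma> j) * (\<Prod>a\<in>{0..<n} - {j}. A $$ (a, \<sigma> a))))"
proof -
  have R: "replace_row A j v \<in> carrier_mat n n"
    using A by (simp add: replace_row_def)
  have "(\<Prod>a = 0..<n. replace_row A j v $$ (a, \<sigma> a)) =
      v (\<sigma> j) * (\<Prod>a\<in>{0..<n} - {j}. A $$ (a, \<sigma> a))" if "\<sigma> permutes {0..<n}" for \<sigma>
  proof -
    have less: "\<sigma> a < n" if "a < n" for a
      using \<open>\<sigma> permutes {0..<n}\<close> that by (metis atLeast0LessThan lessThan_iff permutes_in_image)
    have "(\<Prod>a = 0..<n. replace_row A j v $$ (a, \<sigma> a)) =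
        replace_row A j v $$ (j, \<sigma> j) * (\<Prod>a\<in>{0..<n} - {j}. replace_row A j v $$ (a, \<sigma> a))"
      using j by (intro prod.remove) auto
    also have "(\<Prod>a\<in>{0..<n} - {j}. replace_row A j v $$ (a, \<sigma> a)) =
        (\<Prod>a\<in>{0..<n} - {j}. A $$ (a, \<sigma> a))"
      by (rule prod.cong) (use A less in \<open>auto simp: replace_row_def\<close>)
    finally show ?thesis
      using A j less by (simp add: replace_row_def)
  qed
  then show ?thesis
    unfolding det_def'[OF R] by (intro sum.cong) auto
qed

text \<open>Both expansions of the determinant of \<open>A\<close> with row \<open>j\<close> replaced by the \<open>k\<close>-th unit vector.\<close>

lemma cofactor_permutations:
  fixes A :: "'a :: comm_ring_1 mat"
  assumes A: "A \<in> carrier_mat n n" and j: "j < n" and k: "k < n"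
  shows "cofactor A j k =
    (\<Sum>\<sigma> | \<sigma> permutes {0..<n} \<and> \<sigma> j = k. signof \<sigma> * (\<Prod>a\<in>{0..<n} - {j}. A $$ (a, \<sigma> a)))"
proof -
  have "cofactor A j k = (\<Sum>b<n. (if b = k then 1 else 0) * cofactor A j b)"
    using k by (simp add: if_distrib[of "\<lambda>x. x * _"] cong: if_cong)
  also have "\<dots> = (\<Sum>\<sigma> | \<sigma> permutes {0..<n}. signof \<sigma> *
      ((if \<sigma> j = k then 1 else 0) * (\<Prod>a\<in>{0..<n} - {j}. A $$ (a, \<sigma> a))))"
    unfolding det_replace_row_cofactor[OF A j, symmetric] det_replace_row_permutations[OF A j] ..
  also have "\<dots> = (\<Sum>\<sigma> | \<sigma> permutes {0..<n} \<and> \<sigma> j = k.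
      signof \<sigma> * (\<Prod>a\<in>{0..<n} - {j}. A $$ (a, \<sigma> a)))"
    by (rule sum.mono_neutral_cong_right) (auto simp: finite_permutations)
  finally show ?thesis .
qed

lemma fps_deriv_prod:
  fixes f :: "'b \<Rightarrow> 'a :: comm_ring_1 fps"
  assumes "finite I"
  shows "fps_deriv (prod f I) = (\<Sum>i\<in>I. fps_deriv (f i) * prod f (I - {i}))"
  using assms
proof (induction I)
  case (insert x I)
  have "prod f (insert x I - {i}) = f x * prod f (I - {i})" if "i \<in> I" for i
  proof -
    have "insert x I - {i} = insert x (I - {i})" using that insert.hyps by auto
    then show ?thesis using insert.hyps by simp
  qed
  then show ?case
    using insert by (simp add: sum_distrib_left mult_ac)
qed simp

text \<open>Jacobi's formula: differentiating a product of entries, one from each row, replaces one row by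
its derivative.\<close>

lemma fps_deriv_det:
  fixes A :: "'a :: comm_ring_1 fps mat"
  assumes A: "A \<in> carrier_mat n n"
  shows "fps_deriv (det A) = (\<Sum>i<n. \<Sum>j<n. fps_deriv (A $$ (i, j)) * cofactor A i j)"
proof -
  have sgn: "fps_deriv (signof \<sigma> * x) = signof \<sigma> * fps_deriv x" for \<sigma> and x :: "'a fps"
    by simp
  have "fps_deriv (det A) = (\<Sum>\<sigma> | \<sigma> permutes {0..<n}. \<Sum>i<n.
      signof \<sigma> * (fps_deriv (A $$ (i, \<sigma> i)) * (\<Prod>a\<in>{0..<n} - {i}. A $$ (a, \<sigma> a))))"
    by (simp add: det_def'[OF A] fps_deriv_sum sgn fps_deriv_prod sum_distrib_left lessThan_atLeast0)
  also have "\<dots> = (\<Sum>i<n. det (replace_row A i (\<lambda>j. fps_deriv (A $$ (i, j)))))"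
    by (subst sum.swap) (simp add: det_replace_row_permutations[OF A])
  finally show ?thesis
    by (simp add: det_replace_row_cofactor[OF A])
qed

lemma coeff_prod_affine:
  fixes c d :: "'b \<Rightarrow> 'a :: comm_ring_1"
  assumes "finite I"
  shows "fps_nth (\<Prod>i\<in>I. fps_const (c i) - fps_X * fps_const (d i)) (card I) = (\<Prod>i\<in>I. - d i)"
proof -
  \<comment> \<open>The induction needs that the product is a polynomial of degree at most \<open>card I\<close>.\<close>
  have "fps_nth (\<Prod>i\<in>I. fps_const (c i) - fps_X * fps_const (d i)) (card I) = (\<Prod>i\<in>I. - d i) \<and>
     (\<forall>k>card I. fps_nth (\<Prod>i\<in>I. fps_const (c i) - fps_X * fps_const (d i)) k = 0)"
    using assms
    by (induction I) (auto simp: left_diff_distrib mult.assoc)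
  then show ?thesis ..
qed

lemma pow_mat_Suc_left:
  assumes "A \<in> carrier_mat n n"
  shows "A ^\<^sub>m Suc k = A * A ^\<^sub>m k"
proof (induction k)
  case (Suc k)
  have "A ^\<^sub>m Suc (Suc k) = (A * A ^\<^sub>m k) * A" using Suc.IH by simp
  also have "\<dots> = A * (A ^\<^sub>m k * A)"
    by (rule assoc_mult_mat) (use assms in auto)
  finally show ?case by simp
qed (use assms in simp)

lemma mult_mat_entry:
  assumes "A \<in> carrier_mat n n" "B \<in> carrier_mat n n" "i < n" "j < n"
  shows "(A * B) $$ (i, j) = (\<Sum>k<n. A $$ (i, k) * B $$ (k, j))"
  using assms by (simp add: scalar_prod_def lessThan_atLeast0)

text \<open>If all power sums \<open>tr (X ^ m)\<close>, \<open>m \<ge> 1\<close>, vanish, then \<open>X\<close> has the characteristic polynomial of a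
nilpotent matrix and \<open>X ^ (n - 1)\<close> is the adjugate of \<open>- X\<close>; this is stated here with the adjugate
written out as a sum over permutations. The ring may have zero divisors, so the argument avoids eigenvalues.
Let \<open>M = 1 - t X\<close> over the power series in \<open>t\<close>. Its inverse is the geometric series
\<open>G = (\<Sum>m. t ^ m X ^ m)\<close>, hence the adjugate of \<open>M\<close> is \<open>det M \<cdot> G\<close>. By Jacobi's formula the derivative
of \<open>det M\<close> is \<open>- det M\<close> times the generating function of the traces, that is \<open>0\<close>. As there is no torsion,
\<open>det M\<close> is the constant \<open>1\<close>, so the adjugate of \<open>1 - t X\<close> is \<open>G\<close>, and the claim is the comparison of
the coefficients of \<open>t ^ (n - 1)\<close>: the entries of the adjugate have degree at most \<open>n - 1\<close>, and their
leading terms come from \<open>- t X\<close> alone.\<close>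

lemma pow_mat_eq_cofactor_if_traces_vanish:
  fixes X :: "'a :: comm_ring_1 mat"
  assumes X: "X \<in> carrier_mat n n" and jk: "j < n" "k < n"
    and torsion_free: "\<And>m (x :: 'a). of_nat (Suc m) * x = 0 \<Longrightarrow> x = 0"
    and traces: "\<And>m. (\<Sum>a<n. (X ^\<^sub>m Suc m) $$ (a, a)) = 0"
  shows "(X ^\<^sub>m (n - 1)) $$ (k, j) =
    (\<Sum>\<sigma> | \<sigma> permutes {0..<n} \<and> \<sigma> j = k. signof \<sigma> * (\<Prod>a\<in>{0..<n} - {j}. - (X $$ (a, \<sigma> a))))"
proof -
  define M where "M = mat n n (\<lambda>(a, b).
    fps_const (if a = b then 1 else 0) - fps_X * fps_const (X $$ (a, b)))"
  define G where "G = mat n n (\<lambda>(a, b). Abs_fps (\<lambda>m. (X ^\<^sub>m m) $$ (a, b)))"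
  have M: "M \<in> carrier_mat n n" and G: "G \<in> carrier_mat n n"
    by (simp_all add: M_def G_def)
  have power_sum: "(\<Sum>c<n. X $$ (a, c) * (X ^\<^sub>m m) $$ (c, b)) = (X ^\<^sub>m Suc m) $$ (a, b)"
    if "a < n" "b < n" for a b m
    using X that by (simp only: pow_mat_Suc_left[OF X] mult_mat_entry[OF X pow_carrier_mat[OF X]])
  have MG: "M * G = 1\<^sub>m n"
  proof (rule eq_matI)
    fix a b assume "a < dim_row (1\<^sub>m n)" "b < dim_col (1\<^sub>m n)"
    then have ab: "a < n" "b < n" by simp_all
    have "(M * G) $$ (a, b) = G $$ (a, b) - fps_X * (\<Sum>c<n. fps_const (X $$ (a, c)) * G $$ (c, b))"
    proof -
      have "(M * G) $$ (a, b) =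
          (\<Sum>c<n. (if c = a then G $$ (c, b) else 0) - fps_X * (fps_const (X $$ (a, c)) * G $$ (c, b)))"
        unfolding mult_mat_entry[OF M G ab]
        by (rule sum.cong) (use ab in \<open>auto simp: M_def left_diff_distrib mult.assoc\<close>)
      then show ?thesis
        using ab by (simp add: sum_subtractf sum_distrib_left)
    qed
    also have "\<dots> = (if a = b then 1 else 0)"
    proof (rule fps_ext)
      fix m
      show "fps_nth (G $$ (a, b) - fps_X * (\<Sum>c<n. fps_const (X $$ (a, c)) * G $$ (c, b))) m =
          fps_nth (if a = b then 1 else 0) m"
      proof (cases m)
        case 0
        then show ?thesis using X ab by (simp add: G_def)
      next
        case (Suc l)
        have "(\<Sum>c<n. X $$ (a, c) * fps_nth (G $$ (c, b)) l) = (X ^\<^sub>m Suc l) $$ (a, b)"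
          using power_sum[OF ab, of l] ab by (simp add: G_def)
        then show ?thesis using Suc ab by (simp add: G_def fps_sum_nth)
      qed
    qed
    finally show "(M * G) $$ (a, b) = 1\<^sub>m n $$ (a, b)" using ab by simp
  qed (use M G in auto)
  note adj = adj_mat[OF M]
  have "adj_mat M = adj_mat M * (M * G)" using adj(1) by (simp add: MG)
  also have "\<dots> = adj_mat M * M * G" by (rule assoc_mult_mat[symmetric, OF adj(1) M G])
  also have "\<dots> = det M \<cdot>\<^sub>m G" using G by (simp add: adj(3) mult_smult_assoc_mat[of _ n n])
  finally have "adj_mat M $$ (b, a) = det M * G $$ (b, a)" if "a < n" "b < n" for a b
    using that G by simp
  then have cof: "cofactor M a b = det M * G $$ (b, a)" if "a < n" "b < n" for a b
    using that M by (simp add: adj_mat_def)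
  have "fps_deriv (det M) =
      (\<Sum>a<n. \<Sum>b<n. - fps_const (X $$ (a, b)) * (det M * G $$ (b, a)))"
    unfolding fps_deriv_det[OF M] by (intro sum.cong refl) (simp add: cof, simp add: M_def)
  also have "\<dots> = - det M * (\<Sum>a<n. \<Sum>b<n. fps_const (X $$ (a, b)) * G $$ (b, a))"
    by (simp add: sum_distrib_left sum_negf mult_ac del: fps_const_neg)
  also have "(\<Sum>a<n. \<Sum>b<n. fps_const (X $$ (a, b)) * G $$ (b, a)) = 0"
  proof (rule fps_ext)
    fix m
    have "fps_nth (\<Sum>a<n. \<Sum>b<n. fps_const (X $$ (a, b)) * G $$ (b, a)) m =
        (\<Sum>a<n. \<Sum>b<n. X $$ (a, b) * (X ^\<^sub>m m) $$ (b, a))"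
      by (simp add: fps_sum_nth G_def)
    also have "\<dots> = (\<Sum>a<n. (X ^\<^sub>m Suc m) $$ (a, a))"
      by (rule sum.cong[OF refl]) (rule power_sum, simp_all)
    also note traces
    finally show "fps_nth (\<Sum>a<n. \<Sum>b<n. fps_const (X $$ (a, b)) * G $$ (b, a)) m = fps_nth 0 m"
      by simp
  qed
  finally have deriv0: "fps_deriv (det M) = 0" by simp
  have "fps_nth (det M) (Suc m) = 0" for m
    using arg_cong[OF deriv0, of "\<lambda>f. fps_nth f m"] torsion_free[of m] by simp
  moreover have "fps_nth (det M) 0 = 1"
  proof -
    interpret comm_ring_hom "\<lambda>f :: 'a fps. fps_nth f 0"
      by unfold_locales auto
    have "map_mat (\<lambda>f. fps_nth f 0) M = 1\<^sub>m n"
      by (rule eq_matI) (auto simp: M_def)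
    then show ?thesis using hom_det[of M] by simp
  qed
  ultimately have "det M = 1"
    by (intro fps_ext) (metis fps_one_nth not0_implies_Suc)
  then have "(X ^\<^sub>m (n - 1)) $$ (k, j) = fps_nth (cofactor M j k) (n - 1)"
    using jk by (simp add: cof G_def)
  also have "\<dots> = (\<Sum>\<sigma> | \<sigma> permutes {0..<n} \<and> \<sigma> j = k. signof \<sigma> *
      fps_nth (\<Prod>a\<in>{0..<n} - {j}. M $$ (a, \<sigma> a)) (n - 1))"
    by (simp add: cofactor_permutations[OF M jk] fps_sum_nth flip: fps_of_int)
  also have "\<dots> = (\<Sum>\<sigma> | \<sigma> permutes {0..<n} \<and> \<sigma> j = k. signof \<sigma> *
      (\<Prod>a\<in>{0..<n} - {j}. - (X $$ (a, \<sigma> a))))"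
  proof (intro sum.cong refl)
    fix \<sigma> assume "\<sigma> \<in> {\<sigma>. \<sigma> permutes {0..<n} \<and> \<sigma> j = k}"
    then have less: "\<sigma> a < n" if "a < n" for a
      using that by (metis (no_types, lifting) atLeast0LessThan lessThan_iff mem_Collect_eq permutes_in_image)
    have "(\<Prod>a\<in>{0..<n} - {j}. M $$ (a, \<sigma> a)) = (\<Prod>a\<in>{0..<n} - {j}.
        fps_const (if a = \<sigma> a then 1 else 0) - fps_X * fps_const (X $$ (a, \<sigma> a)))"
      by (rule prod.cong) (use less in \<open>auto simp: M_def\<close>)
    then show "signof \<sigma> * fps_nth (\<Prod>a\<in>{0..<n} - {j}. M $$ (a, \<sigma> a)) (n - 1) =
        signof \<sigma> * (\<Prod>a\<in>{0..<n} - {j}. - (X $$ (a, \<sigma> a)))"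
      using coeff_prod_affine[of "{0..<n} - {j}" "\<lambda>a. if a = \<sigma> a then 1 else 0" "\<lambda>a. X $$ (a, \<sigma> a)"] jk
      by simp
  qed
  finally show ?thesis .
qed

section \<open>Reduction to signed Eulerian trails\<close>

text \<open>A walk is the list of its edges, where the pair \<open>(a, b)\<close> is an edge from \<open>a\<close> to \<open>b\<close>.\<close>

fun walk :: "nat \<Rightarrow> (nat \<times> nat) list \<Rightarrow> nat \<Rightarrow> bool" where
  "walk i [] j \<longleftrightarrow> i = j"
| "walk i (e # es) j \<longleftrightarrow> fst e = i \<and> walk (snd e) es j"

definition walks :: "nat \<Rightarrow> nat \<Rightarrow> nat \<Rightarrow> nat \<Rightarrow> (nat \<times> nat) list set" where
  "walks n i j m = {es. set es \<subseteq> {..<n} \<times> {..<n} \<and> length es = m \<and> walk i es j}"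

lemma finite_walks [simp]: "finite (walks n i j m)"
  unfolding walks_def
  by (rule finite_subset[OF _ finite_lists_length_eq[of "{..<n} \<times> {..<n}" m]]) auto

lemma walks_Suc:
  assumes "i < n"
  shows "walks n i j (Suc m) = (\<Union>k<n. (#) (i, k) ` walks n k j m)"
proof
  show "walks n i j (Suc m) \<subseteq> (\<Union>k<n. (#) (i, k) ` walks n k j m)"
  proof
    fix es assume "es \<in> walks n i j (Suc m)"
    then obtain k es' where "es = (i, k) # es'" "k < n" "es' \<in> walks n k j m"
      by (cases es) (auto simp: walks_def)
    then show "es \<in> (\<Union>k<n. (#) (i, k) ` walks n k j m)" by blast
  qed
qed (use assms in \<open>auto simp: walks_def\<close>)

lemma foldr_mult_carrier:
  "(\<And>M. M \<in> set Ms \<Longrightarrow> M \<in> carrier_mat n n) \<Longrightarrow> foldr (*) Ms (1\<^sub>m n) \<in> carrier_mat n n"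
  by (induction Ms) (auto intro: mult_carrier_mat)

lemma matrix_product_entry_walks:
  fixes Ms :: "'a :: semiring_1 mat list"
  assumes "\<And>M. M \<in> set Ms \<Longrightarrow> M \<in> carrier_mat n n" "i < n" "j < n"
  shows "foldr (*) Ms (1\<^sub>m n) $$ (i, j) =
    (\<Sum>es\<in>walks n i j (length Ms). prod_list (map2 ($$) Ms es))"
  using assms(1,2)
proof (induction Ms arbitrary: i)
  case Nil
  have "walks n i j 0 = (if i = j then {[]} else {})" by (auto simp: walks_def)
  then show ?case using Nil assms(3) by simp
next
  case (Cons M Ms)
  have M: "M \<in> carrier_mat n n" and tail: "foldr (*) Ms (1\<^sub>m n) \<in> carrier_mat n n"
    using Cons.prems(1) by (auto intro: foldr_mult_carrier)
  have "foldr (*) (M # Ms) (1\<^sub>m n) $$ (i, j) =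
      (\<Sum>k<n. M $$ (i, k) * foldr (*) Ms (1\<^sub>m n) $$ (k, j))"
    using M tail Cons.prems(2) assms(3) by (simp add: scalar_prod_def lessThan_atLeast0)
  also have "\<dots> = (\<Sum>k<n. \<Sum>es\<in>walks n k j (length Ms). prod_list (map2 ($$) (M # Ms) ((i, k) # es)))"
    by (rule sum.cong) (use Cons in \<open>auto simp: sum_distrib_left\<close>)
  also have "\<dots> = (\<Sum>k<n. \<Sum>es\<in>(#) (i, k) ` walks n k j (length Ms). prod_list (map2 ($$) (M # Ms) es))"
    by (simp add: sum.reindex)
  also have "\<dots> = (\<Sum>es\<in>walks n i j (Suc (length Ms)). prod_list (map2 ($$) (M # Ms) es))"
    unfolding walks_Suc[OF Cons.prems(2)] by (rule sum.UNION_disjoint[symmetric]) auto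
  finally show ?case by simp
qed

lemma walk_degrees:
  assumes "walk i es j"
  shows "length (filter (\<lambda>e. fst e = r) es) + of_bool (r = j) =
    length (filter (\<lambda>e. snd e = r) es) + of_bool (r = i)"
  using assms
proof (induction es arbitrary: i)
  case (Cons e es)
  then have "length (filter (\<lambda>e. fst e = r) es) + of_bool (r = j) =
      length (filter (\<lambda>e. snd e = r) es) + of_bool (r = snd e)" "fst e = i"
    by simp_all
  then show ?case by (auto simp: of_bool_def split: if_splits)
qed simp

lemma length_filter_fst_eq_card:
  assumes "distinct es"
  shows "length (filter (\<lambda>e. fst e = r) es) = card {b. (r, b) \<in> set es}"
proof -
  have "{x. fst x = r} \<inter> set es = Pair r ` {b. (r, b) \<in> set es}" by force
  then show ?thesis
    by (simp add: distinct_length_filter[OF assms] card_image inj_on_def)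
qed

lemma length_filter_snd_eq_card:
  assumes "distinct es"
  shows "length (filter (\<lambda>e. snd e = r) es) = card {a. (a, r) \<in> set es}"
proof -
  have "{x. snd x = r} \<inter> set es = (\<lambda>a. (a, r)) ` {a. (a, r) \<in> set es}" by force
  then show ?thesis
    by (simp add: distinct_length_filter[OF assms] card_image inj_on_def)
qed

text \<open>For a duplicate-free \<open>xs\<close> this is the sign of the permutation that arranges \<open>xs\<close> into \<open>es\<close>, and \<open>0\<close>
if \<open>es\<close> is no rearrangement of \<open>xs\<close>. Written as a determinant it needs no choice of that permutation.\<close>

definition matching_det :: "'e list \<Rightarrow> 'e list \<Rightarrow> int" where
  "matching_det xs es = det (mat (length xs) (length xs) (\<lambda>(r, k). of_bool (xs ! r = es ! k)))"

lemma mset_eq_if_matching_det_nonzero: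
  assumes "matching_det xs es \<noteq> 0" "length es = length xs"
  shows "mset es = mset xs"
proof -
  define m where "m = length xs"
  let ?M = "mat m m (\<lambda>(r, k). of_bool (xs ! r = es ! k)) :: int mat"
  have "det ?M = (\<Sum>\<sigma> | \<sigma> permutes {0..<m}. signof \<sigma> * (\<Prod>r = 0..<m. ?M $$ (r, \<sigma> r)))"
    by (rule det_def') simp
  then have "(\<Sum>\<sigma> | \<sigma> permutes {0..<m}. signof \<sigma> * (\<Prod>r = 0..<m. ?M $$ (r, \<sigma> r))) \<noteq> 0"
    using assms(1) unfolding matching_det_def m_def by metis
  then obtain \<sigma> where \<sigma>: "\<sigma> permutes {0..<m}" "(\<Prod>r = 0..<m. ?M $$ (r, \<sigma> r)) \<noteq> 0"
    by (metis (no_types, lifting) mem_Collect_eq mult_zero_right sum.neutral)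
  have "xs ! r = es ! \<sigma> r" if "r < m" for r
  proof -
    have "\<sigma> r < m" using that permutes_in_image[OF \<sigma>(1), of r] by simp
    moreover have "?M $$ (r, \<sigma> r) \<noteq> 0" using \<sigma>(2) that by simp
    ultimately show ?thesis using that by (simp split: if_splits)
  qed
  then have "xs = permute_list \<sigma> es"
    using assms(2) by (intro nth_equalityI) (simp_all add: permute_list_def m_def)
  then have "mset xs = mset (permute_list \<sigma> es)" by (rule arg_cong)
  also have "\<dots> = mset es"
    by (rule mset_permute_list) (use \<sigma>(1) in \<open>unfold m_def assms(2) atLeast0LessThan\<close>)
  finally show ?thesis ..
qed

text \<open>Reordering the columns is multiplication by the permutation matrix whose determinant is
\<open>matching_det xs es\<close>.\<close>

lemma det_entry_mat_reorder:
  fixes A :: "nat \<Rightarrow> 'a :: comm_ring_1 mat"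
  assumes "distinct xs" "length xs = 2 * n - 1" "length es = 2 * n - 1" "set es \<subseteq> set xs"
  shows "det (entry_mat n A es) = of_int (matching_det xs es) * det (entry_mat n A xs)"
proof -
  define m where "m = 2 * n - 1"
  let ?P = "mat m m (\<lambda>(r, k). of_bool (xs ! r = es ! k))"
  have "entry_mat n A es = entry_mat n A xs * (?P :: 'a mat)"
  proof (rule eq_matI)
    fix r k assume "r < dim_row (entry_mat n A xs * (?P :: 'a mat))" "k < dim_col (entry_mat n A xs * (?P :: 'a mat))"
    then have rk: "r < m" "k < m" by (simp_all add: entry_mat_def m_def)
    then obtain l where l: "l < m" "xs ! l = es ! k"
      using assms by (metis in_set_conv_nth m_def nth_mem subsetD)
    have index: "xs ! q = es ! k \<longleftrightarrow> q = l" if "q < m" for q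
      using nth_eq_iff_index_eq[OF assms(1), of q l] that l assms(2) by (simp add: m_def)
    have "(entry_mat n A xs * (?P :: 'a mat)) $$ (r, k) =
        (\<Sum>q<m. A r $$ (xs ! q) * of_bool (xs ! q = es ! k))"
      using rk by (simp add: entry_mat_def scalar_prod_def lessThan_atLeast0 m_def)
    also have "\<dots> = (\<Sum>q<m. if q = l then A r $$ (es ! k) else 0)"
      by (rule sum.cong) (auto simp: index l(2))
    also have "\<dots> = entry_mat n A es $$ (r, k)"
      using l rk by (simp add: entry_mat_def m_def)
    finally show "entry_mat n A es $$ (r, k) = (entry_mat n A xs * (?P :: 'a mat)) $$ (r, k)" ..
  qed (simp_all add: entry_mat_def m_def)
  moreover have "det (?P :: 'a mat) = of_int (matching_det xs es)"
  proof -
    interpret comm_ring_hom "of_int :: int \<Rightarrow> 'a" by unfold_locales auto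
    have "(?P :: 'a mat) = map_mat of_int (?P :: int mat)"
      by (rule eq_matI) auto
    then show ?thesis using assms(2) by (simp add: matching_det_def m_def)
  qed
  moreover have "det (entry_mat n A xs * (?P :: 'a mat)) = det (entry_mat n A xs) * det (?P :: 'a mat)"
    by (rule det_mult[of _ m]) (simp_all add: entry_mat_def m_def)
  ultimately show ?thesis by (simp add: mult.commute)
qed

lemma det_entry_mat_repeated:
  fixes A :: "nat \<Rightarrow> 'a :: comm_ring_1 mat"
  assumes "length es = 2 * n - 1" "\<not> distinct es"
  shows "det (entry_mat n A es) = 0"
proof -
  obtain k l where kl: "k < length es" "l < length es" "k \<noteq> l" "es ! k = es ! l"
    using assms(2) by (auto simp: distinct_conv_nth)
  then show ?thesis
    using assms(1)
    by (intro det_identical_columns[of _ "2 * n - 1" k l]) (auto simp: entry_mat_def intro: eq_vecI)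
qed

text \<open>Expand every product of matrices over the walks from \<open>i\<close> to \<open>j\<close>. For a fixed walk the alternating
sum over the order of the factors is a determinant.\<close>

lemma antisymmetrisation_entry_walks:
  fixes A :: "nat \<Rightarrow> 'a :: comm_ring_1 mat"
  assumes A: "\<And>r. r < 2 * n - 1 \<Longrightarrow> A r \<in> carrier_mat n n" and ij: "i < n" "j < n"
  shows "antisymmetrisation n (2 * n - 1) A $$ (i, j) =
    (\<Sum>es\<in>walks n i j (2 * n - 1). det (entry_mat n A es))"
proof -
  define m where "m = 2 * n - 1"
  have "perm_prod n m A \<pi> $$ (i, j) = (\<Sum>es\<in>walks n i j m. \<Prod>k = 0..<m. A (\<pi> k) $$ (es ! k))"
    if "\<pi> permutes {0..<m}" for \<pi>
  proof -
    have "\<pi> k < m" if "k < m" for k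
      using that permutes_in_image[OF \<open>\<pi> permutes {0..<m}\<close>, of k] by simp
    then have "perm_prod n m A \<pi> $$ (i, j) =
        (\<Sum>es\<in>walks n i j m. prod_list (map2 ($$) (map (\<lambda>k. A (\<pi> k)) [0..<m]) es))"
      unfolding perm_prod_def
      by (subst matrix_product_entry_walks) (use A ij in \<open>auto simp: m_def\<close>)
    also have "\<dots> = (\<Sum>es\<in>walks n i j m. \<Prod>k = 0..<m. A (\<pi> k) $$ (es ! k))"
    proof (rule sum.cong[OF refl])
      fix es assume "es \<in> walks n i j m"
      then have "length es = m" by (simp add: walks_def)
      then have "map2 ($$) (map (\<lambda>k. A (\<pi> k)) [0..<m]) es = map (\<lambda>k. A (\<pi> k) $$ (es ! k)) [0..<m]"
        by (intro nth_equalityI) auto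
      then show "prod_list (map2 ($$) (map (\<lambda>k. A (\<pi> k)) [0..<m]) es) = (\<Prod>k = 0..<m. A (\<pi> k) $$ (es ! k))"
        by (simp add: prod.distinct_set_conv_list[symmetric])
    qed
    finally show ?thesis .
  qed
  then have "antisymmetrisation n m A $$ (i, j) =
      (\<Sum>\<pi> | \<pi> permutes {0..<m}. signof \<pi> * (\<Sum>es\<in>walks n i j m. \<Prod>k = 0..<m. A (\<pi> k) $$ (es ! k)))"
    using ij by (simp add: antisymmetrisation_def)
  also have "\<dots> = (\<Sum>es\<in>walks n i j m. \<Sum>\<pi> | \<pi> permutes {0..<m}.
      signof \<pi> * (\<Prod>k = 0..<m. A (\<pi> k) $$ (es ! k)))"
    unfolding sum_distrib_left by (rule sum.swap)
  also have "\<dots> = (\<Sum>es\<in>walks n i j m. det (entry_mat n A es))"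
  proof (rule sum.cong[OF refl])
    fix es
    have "det (entry_mat n A es) =
        (\<Sum>\<pi> | \<pi> permutes {0..<m}. signof \<pi> * (\<Prod>k<m. entry_mat n A es $$ (\<pi> k, k)))"
      by (rule det_col) (simp add: entry_mat_def m_def)
    also have "\<dots> = (\<Sum>\<pi> | \<pi> permutes {0..<m}. signof \<pi> * (\<Prod>k = 0..<m. A (\<pi> k) $$ (es ! k)))"
    proof (rule sum.cong[OF refl])
      fix \<pi> assume "\<pi> \<in> {\<pi>. \<pi> permutes {0..<m}}"
      then have "\<pi> k < m" if "k < m" for k
        using that permutes_in_image[of \<pi> "{0..<m}" k] by simp
      then show "signof \<pi> * (\<Prod>k<m. entry_mat n A es $$ (\<pi> k, k)) =
          signof \<pi> * (\<Prod>k = 0..<m. A (\<pi> k) $$ (es ! k))"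
        by (simp add: entry_mat_def m_def lessThan_atLeast0)
    qed
    finally show "(\<Sum>\<pi> | \<pi> permutes {0..<m}. signof \<pi> * (\<Prod>k = 0..<m. A (\<pi> k) $$ (es ! k))) =
        det (entry_mat n A es)" ..
  qed
  finally show ?thesis by (simp add: m_def)
qed

text \<open>A walk that repeats an edge contributes a determinant with two equal columns. The other walks are
grouped by their set of edges \<open>\<nu>\<close>, of which they are Eulerian trails; since a trail leaves every vertex as often
as it enters it, up to the two ends, only the \<open>\<nu>\<close> with the prescribed difference of weights occur. This
reduces the claim to the signed number of Eulerian trails, an integer that no longer involves the
matrices.\<close>

lemma antisymmetrisation_entry_types:
  fixes A :: "nat \<Rightarrow> 'a :: comm_ring_1 mat"
  assumes A: "\<And>r. r < 2 * n - 1 \<Longrightarrow> A r \<in> carrier_mat n n" and ij: "i < n" "j < n"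
    and ord: "\<And>\<nu>. is_type n \<nu> \<Longrightarrow> distinct (ord \<nu>) \<and> set (ord \<nu>) = \<nu>"
  shows "antisymmetrisation n (2 * n - 1) A $$ (i, j) =
    (\<Sum>\<nu> | is_type n \<nu> \<and> weight_p n \<nu> - weight_q n \<nu> = unit_vec n i - unit_vec n j.
       of_int (\<Sum>es\<in>walks n i j (2 * n - 1). matching_det (ord \<nu>) es) * det (entry_mat n A (ord \<nu>)))"
proof -
  define m where "m = 2 * n - 1"
  define Types where
    "Types = {\<nu>. is_type n \<nu> \<and> weight_p n \<nu> - weight_q n \<nu> = (unit_vec n i - unit_vec n j :: int vec)}"
  define Trails where "Trails = {es \<in> walks n i j m. distinct es}"
  have ord_type: "distinct (ord \<nu>)" "set (ord \<nu>) = \<nu>" "length (ord \<nu>) = m" if "\<nu> \<in> Types" for \<nu>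
    using ord[of \<nu>] that distinct_card[of "ord \<nu>"] by (auto simp: Types_def is_type_def m_def)
  have "finite Types"
    by (rule finite_subset[of _ "Pow ({..<n} \<times> {..<n})"]) (auto simp: Types_def is_type_def)
  have types: "set ` Trails \<subseteq> Types"
  proof
    fix \<nu> assume "\<nu> \<in> set ` Trails"
    then obtain es where es: "es \<in> walks n i j m" "distinct es" "\<nu> = set es"
      by (auto simp: Trails_def)
    have "is_type n \<nu>"
      using es by (auto simp: is_type_def walks_def distinct_card m_def)
    moreover have "weight_p n \<nu> - weight_q n \<nu> = (unit_vec n i - unit_vec n j :: int vec)"
    proof (rule eq_vecI)
      fix r assume "r < dim_vec (unit_vec n i - unit_vec n j :: int vec)"
      then have r: "r < n" by simp
      have "card {b. (r, b) \<in> \<nu>} + of_bool (r = j) = card {a. (a, r) \<in> \<nu>} + of_bool (r = i)"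
        using walk_degrees[of i es j r] es
        by (simp add: walks_def length_filter_fst_eq_card length_filter_snd_eq_card)
      then show "(weight_p n \<nu> - weight_q n \<nu>) $ r = (unit_vec n i - unit_vec n j) $ r"
        using r by (auto simp: weight_p_def weight_q_def unit_vec_def of_bool_def split: if_splits)
    qed (simp add: weight_p_def weight_q_def)
    ultimately show "\<nu> \<in> Types" by (simp add: Types_def)
  qed
  have "antisymmetrisation n (2 * n - 1) A $$ (i, j) = (\<Sum>es\<in>walks n i j m. det (entry_mat n A es))"
    using antisymmetrisation_entry_walks[of n A i j] A ij by (simp add: m_def)
  also have "\<dots> = (\<Sum>es\<in>Trails. det (entry_mat n A es))"
    by (rule sum.mono_neutral_right[OF finite_walks])
      (auto simp: Trails_def walks_def m_def intro: det_entry_mat_repeated)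
  also have "\<dots> = (\<Sum>\<nu>\<in>Types. \<Sum>es\<in>{es \<in> Trails. set es = \<nu>}. det (entry_mat n A es))"
    by (rule sum.group[symmetric]) (use types \<open>finite Types\<close> in \<open>auto simp: Trails_def\<close>)
  also have "\<dots> = (\<Sum>\<nu>\<in>Types. of_int (\<Sum>es\<in>walks n i j m. matching_det (ord \<nu>) es) * det (entry_mat n A (ord \<nu>)))"
  proof (rule sum.cong[OF refl])
    fix \<nu> assume \<nu>: "\<nu> \<in> Types"
    have "(\<Sum>es\<in>{es \<in> Trails. set es = \<nu>}. det (entry_mat n A es)) =
        (\<Sum>es\<in>{es \<in> Trails. set es = \<nu>}. of_int (matching_det (ord \<nu>) es) * det (entry_mat n A (ord \<nu>)))"
      by (rule sum.cong[OF refl], rule det_entry_mat_reorder)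
        (use ord_type[OF \<nu>] in \<open>auto simp: Trails_def walks_def m_def\<close>)
    also have "\<dots> = of_int (\<Sum>es\<in>{es \<in> Trails. set es = \<nu>}. matching_det (ord \<nu>) es) * det (entry_mat n A (ord \<nu>))"
      by (simp add: sum_distrib_right)
    also have "(\<Sum>es\<in>{es \<in> Trails. set es = \<nu>}. matching_det (ord \<nu>) es) =
        (\<Sum>es\<in>walks n i j m. matching_det (ord \<nu>) es)"
    proof (rule sum.mono_neutral_left)
      show "\<forall>es\<in>walks n i j m - {es \<in> Trails. set es = \<nu>}. matching_det (ord \<nu>) es = 0"
      proof (rule ballI, rule ccontr)
        fix es assume es: "es \<in> walks n i j m - {es \<in> Trails. set es = \<nu>}" "matching_det (ord \<nu>) es \<noteq> 0"
        then have "mset es = mset (ord \<nu>)"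
          by (intro mset_eq_if_matching_det_nonzero) (auto simp: walks_def ord_type[OF \<nu>])
        then have "distinct es" "set es = \<nu>"
          using ord_type[OF \<nu>] by (metis mset_eq_imp_distinct_iff, metis set_mset_mset)
        then show False using es by (simp add: Trails_def)
      qed
    qed (auto simp: Trails_def)
    finally show "(\<Sum>es\<in>{es \<in> Trails. set es = \<nu>}. det (entry_mat n A es)) =
        of_int (\<Sum>es\<in>walks n i j m. matching_det (ord \<nu>) es) * det (entry_mat n A (ord \<nu>))" .
  qed
  finally show ?thesis by (simp add: Types_def m_def)
qed

section \<open>Minors of the incidence matrix of a type\<close>

lemma pick_Compl_singleton: "pick (- {s}) k = (if k < s then k else Suc k)"
proof (induction k)
  case 0
  show ?case by (auto intro!: Least_equality simp: Suc_le_eq)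
next
  case (Suc k)
  show ?case
    unfolding pick.simps Suc.IH by (auto intro!: Least_equality simp: Suc_le_eq)
qed

lemma type_mat_del_eq:
  assumes "s < 2 * n"
  shows "type_mat_del n xs s = mat (2 * n - 1) (2 * n - 1)
    (\<lambda>(k, c). type_mat n xs $$ (k, if c < s then c else Suc c))"
proof -
  have "{c. c < 2 * n \<and> c \<in> - {s}} = {..<2 * n} - {s}" by auto
  then have "card {c. c < 2 * n \<and> c \<in> - {s}} = 2 * n - 1"
    using assms by simp
  then show ?thesis
    unfolding type_mat_del_def submatrix_def
    by (intro eq_matI) (auto simp: type_mat_def pick_UNIV pick_Compl_singleton)
qed

text \<open>The columns of \<open>type_mat n xs\<close> add up to zero, because every row has one entry \<open>- 1\<close> and one entry
\<open>1\<close>. Therefore the square matrix obtained by putting the difference of the unit vectors at \<open>s\<close> and \<open>t\<close> on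
top of it is singular, and its Laplace expansion along that row is the difference of the two sides.\<close>

lemma det_type_mat_del_independent:
  assumes xs: "length xs = 2 * n - 1" "set xs \<subseteq> {..<n} \<times> {..<n}" and s: "s < 2 * n" and t: "t < 2 * n"
  shows "(- 1) ^ s * det (type_mat_del n xs s) = (- 1) ^ t * det (type_mat_del n xs t)"
proof (cases "s = t")
  case False
  define N where "N = 2 * n"
  define B :: "int mat" where "B = mat N N (\<lambda>(r, c). case r of
      0 \<Rightarrow> (if c = s then 1 else 0) - (if c = t then 1 else 0) | Suc k \<Rightarrow> type_mat n xs $$ (k, c))"
  have B: "B \<in> carrier_mat N N" by (simp add: B_def)
  have N: "0 < N" using s by (simp add: N_def)
  have minor: "mat_delete B 0 c = type_mat_del n xs c" if "c < N" for c
    unfolding type_mat_del_eq[OF that[unfolded N_def]]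
    by (rule eq_matI) (auto simp: mat_delete_def B_def N_def)
  have "det B = (\<Sum>c<N. ((if c = s then 1 else 0) - (if c = t then 1 else 0)) *
      ((- 1) ^ c * det (type_mat_del n xs c)))"
    unfolding laplace_expansion_row[OF B N]
  proof (rule sum.cong[OF refl])
    fix c assume "c \<in> {..<N}"
    then have "B $$ (0, c) = (if c = s then 1 else 0) - (if c = t then 1 else 0)"
        "cofactor B 0 c = (- 1) ^ c * det (type_mat_del n xs c)"
      using N by (simp_all add: cofactor_def minor, simp add: B_def)
    then show "B $$ (0, c) * cofactor B 0 c =
        ((if c = s then 1 else 0) - (if c = t then 1 else 0)) * ((- 1) ^ c * det (type_mat_del n xs c))"
      by (simp only:)
  qed
  also have "\<dots> = (\<Sum>c<N. (if c = s then (- 1) ^ c * det (type_mat_del n xs c) else 0) -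
      (if c = t then (- 1) ^ c * det (type_mat_del n xs c) else 0))"
    by (rule sum.cong) auto
  also have "\<dots> = (- 1) ^ s * det (type_mat_del n xs s) - (- 1) ^ t * det (type_mat_del n xs t)"
    using s t by (simp add: sum_subtractf N_def)
  finally have det: "det B = (- 1) ^ s * det (type_mat_del n xs s) - (- 1) ^ t * det (type_mat_del n xs t)" .
  have "B *\<^sub>v vec N (\<lambda>_. 1) = 0\<^sub>v N"
  proof (rule eq_vecI)
    fix r assume "r < dim_vec (0\<^sub>v N :: int vec)"
    then have r: "r < N" by simp
    have "(B *\<^sub>v vec N (\<lambda>_. 1)) $ r = (\<Sum>c<N. B $$ (r, c))"
      using r B by (simp add: scalar_prod_def lessThan_atLeast0)
    also have "\<dots> = 0"
    proof (cases r)
      case 0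
      then show ?thesis
        using s t N by (simp add: B_def sum_subtractf N_def)
    next
      case (Suc k)
      obtain a b where ab: "xs ! k = (a, b)" by (cases "xs ! k")
      have k: "k < 2 * n - 1" using r Suc by (simp add: N_def)
      then have "xs ! k \<in> set xs" using xs by simp
      then have less: "a < n" "b < n" using xs(2) ab by auto
      have "(\<Sum>c<N. B $$ (r, c)) =
          (\<Sum>c<N. (if c = n + b then 1 else 0) - (if c = a then 1 else 0))"
        by (rule sum.cong) (use Suc k r less ab in \<open>auto simp: B_def type_mat_def N_def\<close>)
      also have "\<dots> = 0"
        using less by (simp add: sum_subtractf N_def)
      finally show ?thesis .
    qed
    finally show "(B *\<^sub>v vec N (\<lambda>_. 1)) $ r = 0\<^sub>v N $ r" using r by simp
  qed (use B in simp)
  moreover have "vec N (\<lambda>_. 1 :: int) \<noteq> 0\<^sub>v N"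
    using N by (metis index_vec index_zero_vec(1) zero_neq_one)
  ultimately have "det B = 0"
    using det_0_iff_vec_prod_zero[OF B] by (metis vec_carrier)
  then show ?thesis using det by simp
qed simp

section \<open>Permutations that match two functions\<close>

lemma card_permutations_of_set_with_image:
  assumes "finite B" "mset zs = image_mset g (mset_set B)" "finite R" "set zs \<subseteq> R"
  shows "card {ys \<in> permutations_of_set B. map g ys = zs} = (\<Prod>r\<in>R. fact (count (mset zs) r))"
  using assms
proof (induction zs arbitrary: B)
  case Nil
  then have "B = {}" by (simp add: mset_set_empty_iff)
  then have "{ys \<in> permutations_of_set B. map g ys = []} = {[]}" by auto
  then show ?case by simp
next
  case (Cons z zs)
  define Y where "Y = {y \<in> B. g y = z}"
  have Y: "finite Y" "Y \<subseteq> B" using Cons.prems(1) by (auto simp: Y_def)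
  have card_Y: "card Y = Suc (count (mset zs) z)"
  proof -
    have "Suc (count (mset zs) z) = count (image_mset g (mset_set B)) z"
      unfolding Cons.prems(2)[symmetric] by simp
    also have "\<dots> = card Y"
      using Cons.prems(1) by (simp add: count_image_mset Y_def vimage_def Int_def conj_commute)
    finally show ?thesis ..
  qed
  have split: "{ys \<in> permutations_of_set B. map g ys = z # zs} =
      (\<Union>y\<in>Y. (#) y ` {ys \<in> permutations_of_set (B - {y}). map g ys = zs})"
    (is "?L = ?R")
  proof
    show "?L \<subseteq> ?R"
    proof
      fix ys assume ys: "ys \<in> ?L"
      then obtain y ys' where "ys = y # ys'" "g y = z" "map g ys' = zs" by (cases ys) auto
      with ys show "ys \<in> ?R" by (auto simp: Y_def permutations_of_set_def)
    qed
    show "?R \<subseteq> ?L"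
    proof
      fix ys assume "ys \<in> ?R"
      then obtain y ys' where "y \<in> B" "g y = z" "ys = y # ys'" "set ys' = B - {y}" "distinct ys'"
          "map g ys' = zs"
        unfolding Y_def permutations_of_set_def by blast
      then show "ys \<in> ?L" by (simp add: permutations_of_set_def insert_absorb)
    qed
  qed
  have IH: "card {ys \<in> permutations_of_set (B - {y}). map g ys = zs} = (\<Prod>r\<in>R. fact (count (mset zs) r))"
    if "y \<in> Y" for y
  proof (rule Cons.IH)
    have "mset_set B = add_mset y (mset_set (B - {y}))"
      using that Cons.prems(1) by (intro mset_set.remove) (auto simp: Y_def)
    then have "image_mset g (mset_set B) = add_mset z (image_mset g (mset_set (B - {y})))"
      using that by (simp add: Y_def)
    then show "mset zs = image_mset g (mset_set (B - {y}))"
      using Cons.prems(2) by simp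
  qed (use Cons.prems in auto)
  have "card {ys \<in> permutations_of_set B. map g ys = z # zs} =
      (\<Sum>y\<in>Y. card ((#) y ` {ys \<in> permutations_of_set (B - {y}). map g ys = zs}))"
    unfolding split by (rule card_UN_disjoint) (use Y in auto)
  also have "\<dots> = Suc (count (mset zs) z) * (\<Prod>r\<in>R. fact (count (mset zs) r))"
    by (simp add: card_image IH card_Y)
  also have "\<dots> = (\<Prod>r\<in>R. fact (count (mset (z # zs)) r))"
  proof -
    have z: "z \<in> R" using Cons.prems(4) by simp
    have "(\<Prod>r\<in>R - {z}. fact (count (mset (z # zs)) r)) = (\<Prod>r\<in>R - {z}. fact (count (mset zs) r) :: nat)"
      by (rule prod.cong) auto
    then show ?thesis
      by (simp add: prod.remove[OF Cons.prems(3) z] algebra_simps)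
  qed
  finally show ?case .
qed

lemma bij_betw_permutes_permutations_of_set:
  "bij_betw (\<lambda>\<sigma>. map \<sigma> [0..<n]) {\<sigma>. \<sigma> permutes {0..<n}} (permutations_of_set {0..<n})"
proof (rule bij_betw_imageI)
  show inj: "inj_on (\<lambda>\<sigma>. map \<sigma> [0..<n]) {\<sigma>. \<sigma> permutes {0..<n}}"
  proof (rule inj_onI, rule ext)
    fix \<sigma> \<tau> and x :: nat
    assume "\<sigma> \<in> {\<sigma>. \<sigma> permutes {0..<n}}" "\<tau> \<in> {\<sigma>. \<sigma> permutes {0..<n}}"
      and "map \<sigma> [0..<n] = map \<tau> [0..<n]"
    then show "\<sigma> x = \<tau> x"
      by (cases "x < n") (auto simp: permutes_def)
  qed
  show "(\<lambda>\<sigma>. map \<sigma> [0..<n]) ` {\<sigma>. \<sigma> permutes {0..<n}} = permutations_of_set {0..<n}"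
  proof (rule card_subset_eq)
    show "(\<lambda>\<sigma>. map \<sigma> [0..<n]) ` {\<sigma>. \<sigma> permutes {0..<n}} \<subseteq> permutations_of_set {0..<n}"
      by (auto simp: permutations_of_set_def permutes_image distinct_map intro: permutes_inj_on)
    show "card ((\<lambda>\<sigma>. map \<sigma> [0..<n]) ` {\<sigma>. \<sigma> permutes {0..<n}}) = card (permutations_of_set {0..<n})"
      using card_permutations[of "{0..<n}" n] by (simp add: card_image[OF inj])
  qed simp
qed

text \<open>Independently for every value \<open>r\<close>, the permutation maps the fibre of \<open>b\<close> over \<open>r\<close> bijectively onto
the fibre of \<open>g\<close> over \<open>r\<close>. This is where the factorials of the formula come from.\<close>

lemma card_permutations_matching:
  fixes b g :: "nat \<Rightarrow> nat"
  assumes fibres: "\<And>r. card {a. a < n \<and> b a = r} = card {a. a < n \<and> g a = r}"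
    and bound: "\<And>a. a < n \<Longrightarrow> b a < n"
  shows "card {\<sigma>. \<sigma> permutes {0..<n} \<and> (\<forall>a<n. g (\<sigma> a) = b a)} =
    (\<Prod>r<n. fact (card {a. a < n \<and> b a = r}))"
proof -
  have count: "count (image_mset h (mset_set {0..<n})) r = card {a. a < n \<and> h a = r}" for h :: "nat \<Rightarrow> nat" and r
    by (simp add: count_image_mset vimage_def Int_def conj_commute)
  have mset: "mset (map h [0..<n]) = image_mset h (mset_set {0..<n})" for h :: "nat \<Rightarrow> nat"
    by (simp add: atLeast_upt mset_set_set)
  have "bij_betw (\<lambda>\<sigma>. map \<sigma> [0..<n]) {\<sigma> \<in> {\<sigma>. \<sigma> permutes {0..<n}}. \<forall>a<n. g (\<sigma> a) = b a}
      {ys \<in> permutations_of_set {0..<n}. map g ys = map b [0..<n]}"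
    by (rule bij_betw_Collect[OF bij_betw_permutes_permutations_of_set]) auto
  then have "card {\<sigma>. \<sigma> permutes {0..<n} \<and> (\<forall>a<n. g (\<sigma> a) = b a)} =
      card {ys \<in> permutations_of_set {0..<n}. map g ys = map b [0..<n]}"
    by (simp add: bij_betw_same_card)
  also have "\<dots> = (\<Prod>r<n. fact (count (mset (map b [0..<n])) r))"
    by (rule card_permutations_of_set_with_image)
      (use bound in \<open>auto simp del: mset_map simp: mset count fibres intro: multiset_eqI\<close>)
  also have "\<dots> = (\<Prod>r<n. fact (card {a. a < n \<and> b a = r}))"
    by (simp only: mset count)
  finally show ?thesis .
qed

section \<open>Reordering products of odd elements\<close>

lemma mult_of_int_left_commute:
  "x * (of_int z * y) = of_int z * (x * y :: 'a :: ring_1)"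
proof -
  have "x * (of_int z * y) = of_int z * x * y"
    by (simp only: mult_of_int_commute[of z x] mult.assoc)
  then show ?thesis by (simp only: mult.assoc)
qed

lemma mult_power_minus_one_left_commute:
  "x * ((- 1) ^ k * y) = (- 1) ^ k * (x * y :: 'a :: ring_1)"
  by (simp add: minus_one_power_iff)

lemma odd_mult_prod_list:
  assumes "odd_grassmann x" "\<And>a. a \<in> set as \<Longrightarrow> odd_grassmann (y a)"
  shows "x * prod_list (map y as) = (- 1) ^ length as * (prod_list (map y as) * x)"
  using assms(2)
proof (induction as)
  case (Cons a as)
  have "x * y a = - (y a * x)"
    using homogeneous_commute[of False "y a" False x] Cons.prems assms(1) by simp
  then have "x * prod_list (map y (a # as)) = - (y a * (x * prod_list (map y as)))"
    by (simp add: mult.assoc[symmetric])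
  also have "x * prod_list (map y as) = (- 1) ^ length as * (prod_list (map y as) * x)"
    by (rule Cons.IH) (use Cons.prems in auto)
  finally show ?case
    by (simp add: mult_power_minus_one_left_commute mult.assoc)
qed simp

text \<open>Moving each \<open>y a\<close> to the left past \<open>z0\<close> and the preceding factors \<open>z\<close> takes
\<open>1 + 2 + \<dots> + length as\<close> transpositions.\<close>

lemma odd_prod_list_unshuffle:
  assumes "odd_grassmann z0" "\<And>a. a \<in> set as \<Longrightarrow> odd_grassmann (y a)"
    "\<And>a. a \<in> set as \<Longrightarrow> odd_grassmann (z a)"
  shows "z0 * prod_list (map (\<lambda>a. y a * z a) as) = (- 1) ^ (Suc (length as) choose 2) *
    (prod_list (map y as) * (z0 * prod_list (map z as)))"
  using assms
proof (induction as arbitrary: z0)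
  case (Cons a as)
  have "z0 * y a = - (y a * z0)"
    using homogeneous_commute[of False "y a" False z0] Cons.prems by simp
  then have "z0 * prod_list (map (\<lambda>a. y a * z a) (a # as)) =
      - (y a * (z0 * (z a * prod_list (map (\<lambda>a. y a * z a) as))))"
    by (simp add: mult.assoc[symmetric])
  also have "z a * prod_list (map (\<lambda>a. y a * z a) as) = (- 1) ^ (Suc (length as) choose 2) *
      (prod_list (map y as) * (z a * prod_list (map z as)))"
    by (rule Cons.IH) (use Cons.prems in auto)
  also have "z0 * \<dots> = (- 1) ^ (Suc (length as) choose 2) *
      ((z0 * prod_list (map y as)) * (z a * prod_list (map z as)))"
    by (simp only: mult_power_minus_one_left_commute mult.assoc)
  also have "z0 * prod_list (map y as) = (- 1) ^ length as * (prod_list (map y as) * z0)"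
    by (rule odd_mult_prod_list) (use Cons.prems in auto)
  also have "- (y a * ((- 1) ^ k * ((- 1) ^ length as * (prod_list (map y as) * z0) *
        (z a * prod_list (map z as))))) =
      (- 1) ^ (Suc (length as) + k) *
        (prod_list (map y (a # as)) * (z0 * prod_list (map z (a # as))))" for k
    by (simp add: minus_one_power_iff mult.assoc)
  also have "Suc (length as) + (Suc (length as) choose 2) = Suc (length (a # as)) choose 2"
    by (simp add: numeral_2_eq_2)
  finally show ?case .
qed (simp add: numeral_2_eq_2)

definition all_but :: "nat \<Rightarrow> nat \<Rightarrow> nat list" where
  "all_but n j = [0..<j] @ [Suc j..<n]"

lemma all_but_facts:
  assumes "j < n"
  shows "set (all_but n j) = {0..<n} - {j}" "distinct (all_but n j)" "length (all_but n j) = n - 1"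
    "k < n - 1 \<Longrightarrow> all_but n j ! k = (if k < j then k else Suc k)"
  using assms by (auto simp: all_but_def nth_append)

lemma odd_prod_list_move_front:
  assumes "j < n" "\<And>a. a < n \<Longrightarrow> odd_grassmann (z a)"
  shows "z j * prod_list (map z (all_but n j)) = (- 1) ^ j * prod_list (map z [0..<n])"
proof -
  have split: "[0..<n] = [0..<j] @ j # [Suc j..<n]"
    using assms(1) by (metis le_add1 less_imp_add_positive less_or_eq_imp_le upt_add_eq_append upt_conv_Cons add_0)
  have "z j * prod_list (map z [0..<j]) = (- 1) ^ j * (prod_list (map z [0..<j]) * z j)"
    using odd_mult_prod_list[of "z j" "[0..<j]" z] assms by auto
  then show ?thesis
    unfolding split all_but_def by (simp add: mult.assoc[symmetric])
qed

lemma gcoeff_prod_linear_forms_wrong_degree: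
  assumes "card S \<noteq> length cs \<or> infinite S"
  shows "gcoeff (prod_list (map linear_form cs)) S = 0"
proof (cases "finite S")
  case True
  then have "card S \<noteq> length cs" using assms by simp
  then show ?thesis using True
  proof (induction cs arbitrary: S)
    case (Cons c cs)
    have "gcoeff (prod_list (map linear_form cs)) (S - {s}) = 0" if "s \<in> S" for s
      by (rule Cons.IH) (use Cons.prems that card_Suc_Diff1 in fastforce)+
    then show ?case
      using Cons.prems(2) by (simp add: gcoeff_linear_form_mult)
  qed (auto simp: one_grassmann.rep_eq)
qed (use gcoeff in auto)

text \<open>Products of linear forms are alternating. It suffices to compare coefficients, which are
determinants by \<open>gcoeff_prod_linear_forms\<close>.\<close>

lemma prod_linear_forms_permute:
  assumes \<sigma>: "\<sigma> permutes {0..<n}"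
  shows "prod_list (map (\<lambda>a. linear_form (c (\<sigma> a))) [0..<n]) =
    of_int (sign \<sigma>) * prod_list (map (\<lambda>a. linear_form (c a)) [0..<n])"
proof -
  let ?l = "prod_list (map linear_form (map (\<lambda>a. c (\<sigma> a)) [0..<n]))"
  let ?r = "prod_list (map linear_form (map c [0..<n]))"
  have "gcoeff ?l S = sign \<sigma> * gcoeff ?r S" for S
  proof (cases "finite S \<and> card S = n")
    case True
    define L where "L = sorted_list_of_set S"
    have L: "sorted L" "distinct L" "length L = n" "set L = S"
      using True by (auto simp: L_def)
    let ?C = "mat n n (\<lambda>(k, r). c k (L ! r)) :: int mat"
    have less: "\<sigma> k < n" if "k < n" for k
      using permutes_in_image[OF \<sigma>, of k] that by simp
    have "gcoeff ?l S = det (mat n n (\<lambda>(r, k). c (\<sigma> k) (L ! r)))"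
    proof -
      have "mat n n (\<lambda>(r, k). (map (\<lambda>a. c (\<sigma> a)) [0..<n] ! k) (L ! r)) =
          mat n n (\<lambda>(r, k). c (\<sigma> k) (L ! r))"
        by (rule eq_matI) auto
      then show ?thesis
        using gcoeff_prod_linear_forms[of L "map (\<lambda>a. c (\<sigma> a)) [0..<n]"] L by simp
    qed
    also have "\<dots> = det (mat n n (\<lambda>(k, r). c (\<sigma> k) (L ! r)))"
      by (subst det_transpose[of _ n, symmetric]) (auto intro!: arg_cong[of _ _ det] eq_matI)
    also have "mat n n (\<lambda>(k, r). c (\<sigma> k) (L ! r)) = mat n n (\<lambda>(k, r). ?C $$ (\<sigma> k, r))"
      by (rule eq_matI) (auto simp: less)
    also have "det \<dots> = signof \<sigma> * det ?C"
      by (rule det_permute_rows) (use \<sigma> in auto)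
    also have "det ?C = det (mat n n (\<lambda>(r, k). c k (L ! r)))"
      by (subst det_transpose[of _ n, symmetric]) (auto intro!: arg_cong[of _ _ det] eq_matI)
    also have "\<dots> = gcoeff ?r S"
    proof -
      have "mat n n (\<lambda>(r, k). (map c [0..<n] ! k) (L ! r)) = mat n n (\<lambda>(r, k). c k (L ! r))"
        by (rule eq_matI) auto
      then show ?thesis
        using gcoeff_prod_linear_forms[of L "map c [0..<n]"] L by simp
    qed
    finally show ?thesis by simp
  next
    case False
    then have "gcoeff ?l S = 0" "gcoeff ?r S = 0"
      by (auto intro!: gcoeff_prod_linear_forms_wrong_degree simp del: map_map)
    then show ?thesis by (simp only: mult_zero_right)
  qed
  then have "gcoeff ?l = gcoeff (of_int (sign \<sigma>) * ?r)"
    by (simp add: fun_eq_iff gcoeff_of_int_mult)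
  then show ?thesis
    by (simp add: gcoeff_inject comp_def)
qed

lemma prod_list_sum_distrib:
  fixes F :: "'a \<Rightarrow> 'b \<Rightarrow> 'c :: semiring_1"
  assumes "distinct as" "finite B"
  shows "prod_list (map (\<lambda>a. \<Sum>b\<in>B. F a b) as) =
    (\<Sum>f\<in>set as \<rightarrow>\<^sub>E B. prod_list (map (\<lambda>a. F a (f a)) as))"
  using assms(1)
proof (induction as)
  case (Cons a as)
  have "(\<Sum>f\<in>set (a # as) \<rightarrow>\<^sub>E B. prod_list (map (\<lambda>a. F a (f a)) (a # as))) =
      (\<Sum>(b, f)\<in>B \<times> (set as \<rightarrow>\<^sub>E B). prod_list (map (\<lambda>x. F x ((f(a := b)) x)) (a # as)))"
    unfolding list.set(2) PiE_insert_eq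
    by (subst sum.reindex) (use Cons.prems inj_combinator in \<open>auto simp: case_prod_unfold comp_def\<close>)
  also have "\<dots> = (\<Sum>(b, f)\<in>B \<times> (set as \<rightarrow>\<^sub>E B). F a b * prod_list (map (\<lambda>x. F x (f x)) as))"
  proof (rule sum.cong[OF refl], clarify)
    fix b f
    have "map (\<lambda>x. F x ((f(a := b)) x)) as = map (\<lambda>x. F x (f x)) as"
      using Cons.prems by (intro map_cong) auto
    then show "prod_list (map (\<lambda>x. F x ((f(a := b)) x)) (a # as)) = F a b * prod_list (map (\<lambda>x. F x (f x)) as)"
      by (simp only: list.map prod_list.Cons fun_upd_same)
  qed
  also have "\<dots> = (\<Sum>b\<in>B. F a b) * (\<Sum>f\<in>set as \<rightarrow>\<^sub>E B. prod_list (map (\<lambda>x. F x (f x)) as))"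
    by (simp add: sum_product sum.cartesian_product)
  finally show ?case
    using Cons by simp
qed simp

section \<open>Even powers of odd matrices\<close>

lemma pow_mat_square_commute:
  assumes "A \<in> carrier_mat n n"
  shows "A * (A * A) ^\<^sub>m k = (A * A) ^\<^sub>m k * A"
proof (induction k)
  case (Suc k)
  have AA: "A * A \<in> carrier_mat n n" using assms by simp
  note P = pow_carrier_mat[OF AA, of k]
  have "A * (A * A) ^\<^sub>m Suc k = A * (A * A) ^\<^sub>m k * (A * A)"
    using assoc_mult_mat[OF assms P AA] by simp
  also have "\<dots> = (A * A) ^\<^sub>m k * A * (A * A)" by (simp only: Suc.IH)
  also have "\<dots> = (A * A) ^\<^sub>m k * (A * (A * A))" by (rule assoc_mult_mat[OF P assms AA])
  also have "A * (A * A) = A * A * A" by (rule assoc_mult_mat[symmetric, OF assms assms assms])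
  also have "(A * A) ^\<^sub>m k * (A * A * A) = (A * A) ^\<^sub>m Suc k * A"
    using assoc_mult_mat[OF P AA assms] by simp
  finally show ?case .
qed (use assms in simp)

lemma foldr_replicate_odd:
  assumes "A \<in> carrier_mat n n"
  shows "foldr (*) (replicate (Suc (2 * k)) A) (1\<^sub>m n) = A * (A * A) ^\<^sub>m k"
proof (induction k)
  case (Suc k)
  have AA: "A * A \<in> carrier_mat n n" using assms by simp
  note P = pow_carrier_mat[OF AA, of k]
  have "foldr (*) (replicate (Suc (2 * Suc k)) A) (1\<^sub>m n) = A * (A * (A * (A * A) ^\<^sub>m k))"
    using Suc.IH by simp
  also have "A * (A * (A * A) ^\<^sub>m k) = A * A * (A * A) ^\<^sub>m k"
    by (rule assoc_mult_mat[symmetric, OF assms assms P])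
  also have "\<dots> = (A * A) ^\<^sub>m Suc k" by (rule pow_mat_Suc_left[symmetric, OF AA])
  finally show ?case .
qed (use assms in simp)

lemma odd_matrix_mult:
  assumes "A \<in> carrier_mat n n" "B \<in> carrier_mat n n"
    and "\<And>a b. a < n \<Longrightarrow> b < n \<Longrightarrow> homogeneous_parity p (A $$ (a, b))"
    and "\<And>a b. a < n \<Longrightarrow> b < n \<Longrightarrow> homogeneous_parity q (B $$ (a, b))"
    and "a < n" "b < n"
  shows "homogeneous_parity (p = q) ((A * B) $$ (a, b))"
  unfolding mult_mat_entry[OF assms(1,2,5,6)]
  by (intro homogeneous_parity_sum homogeneous_parity_mult) (use assms in auto)

text \<open>Rosset's observation: the entries of \<open>\<Theta> * \<Theta>\<close> are even and hence commute, and
\<open>tr (\<Theta> ^ (2 m)) = 0\<close> for \<open>m \<ge> 1\<close>, because moving the odd matrix \<open>\<Theta>\<close> cyclically from the front of the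
product to its end changes the sign of the trace. So \<open>pow_mat_eq_cofactor_if_traces_vanish\<close> applies to
\<open>\<Theta> * \<Theta>\<close>.\<close>

lemma odd_matrix_even_power_cofactor:
  assumes \<Theta>: "\<Theta> \<in> carrier_mat n n"
    and odd: "\<And>a b. a < n \<Longrightarrow> b < n \<Longrightarrow> odd_grassmann (\<Theta> $$ (a, b))"
    and jk: "j < n" "k < n"
  shows "((\<Theta> * \<Theta>) ^\<^sub>m (n - 1)) $$ (k, j) =
    (\<Sum>\<sigma> | \<sigma> permutes {0..<n} \<and> \<sigma> j = k. of_int (sign \<sigma>) *
      prod_list (map (\<lambda>a. - ((\<Theta> * \<Theta>) $$ (a, \<sigma> a))) (all_but n j)))"
proof -
  define X where "X = map_mat Abs_even_grassmann (\<Theta> * \<Theta>)"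
  have sq: "\<Theta> * \<Theta> \<in> carrier_mat n n" using \<Theta> by simp
  have X: "X \<in> carrier_mat n n" using \<Theta> by (simp add: X_def)
  have even: "homogeneous_parity True ((\<Theta> * \<Theta>) $$ (a, b))" if "a < n" "b < n" for a b
    using odd_matrix_mult[OF \<Theta> \<Theta> odd odd that] by simp
  have X_entry: "of_even (X $$ (a, b)) = (\<Theta> * \<Theta>) $$ (a, b)" if "a < n" "b < n" for a b
    using that \<Theta> even[OF that] by (simp add: X_def Abs_even_grassmann_inverse del: index_mult_mat(1))
  interpret semiring_hom of_even
    by unfold_locales
      (simp_all add: zero_even_grassmann.rep_eq plus_even_grassmann.rep_eq
        one_even_grassmann.rep_eq times_even_grassmann.rep_eq)
  have map_X: "map_mat of_even X = \<Theta> * \<Theta>"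
    by (rule eq_matI) (use X \<Theta> X_entry in \<open>auto simp del: index_mult_mat(1)\<close>)
  have pow: "of_even ((X ^\<^sub>m m) $$ (a, b)) = ((\<Theta> * \<Theta>) ^\<^sub>m m) $$ (a, b)" if "a < n" "b < n" for a b m
    using mat_hom_pow[OF X, of m] that X pow_carrier_mat[OF X, of m] unfolding map_X
    by (metis carrier_matD index_map_mat(1))
  have traces: "(\<Sum>a<n. (X ^\<^sub>m Suc m) $$ (a, a)) = 0" for m
  proof -
    define Y where "Y = \<Theta> * (\<Theta> * \<Theta>) ^\<^sub>m m"
    note P = pow_carrier_mat[OF sq, of m]
    have Y: "Y \<in> carrier_mat n n" using \<Theta> P unfolding Y_def by (rule mult_carrier_mat)
    have pow_even: "homogeneous_parity True (((\<Theta> * \<Theta>) ^\<^sub>m m) $$ (a, b))" if "a < n" "b < n" for a b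
      using that
    proof (induction m arbitrary: a b)
      case 0
      then show ?case using \<Theta> by simp
    next
      case (Suc m)
      show ?case
        using odd_matrix_mult[OF pow_carrier_mat[OF sq] sq Suc.IH even Suc.prems] by simp
    qed
    have Y_odd: "odd_grassmann (Y $$ (a, b))" if "a < n" "b < n" for a b
      using odd_matrix_mult[OF \<Theta> P odd pow_even that] unfolding Y_def by simp
    have \<Theta>Y: "(\<Theta> * \<Theta>) ^\<^sub>m Suc m = \<Theta> * Y"
      unfolding Y_def pow_mat_Suc_left[OF sq] by (rule assoc_mult_mat[OF \<Theta> \<Theta> P])
    have Y\<Theta>: "\<Theta> * Y = Y * \<Theta>"
    proof -
      have "Y * \<Theta> = \<Theta> * ((\<Theta> * \<Theta>) ^\<^sub>m m * \<Theta>)"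
        unfolding Y_def by (rule assoc_mult_mat[OF \<Theta> P \<Theta>])
      then show ?thesis by (simp only: pow_mat_square_commute[OF \<Theta>, symmetric] Y_def)
    qed
    define t where "t = (\<Sum>a<n. (\<Theta> * Y) $$ (a, a))"
    have "t = (\<Sum>a<n. \<Sum>c<n. Y $$ (a, c) * \<Theta> $$ (c, a))"
      unfolding t_def Y\<Theta> by (rule sum.cong[OF refl]) (use mult_mat_entry[OF Y \<Theta>] in simp)
    also have "\<dots> = (\<Sum>c<n. \<Sum>a<n. - (\<Theta> $$ (c, a) * Y $$ (a, c)))"
      by (subst sum.swap, intro sum.cong refl)
        (use homogeneous_commute[OF odd Y_odd] in simp)
    also have "\<dots> = - t"
      unfolding t_def sum_negf
      by (intro arg_cong[of _ _ uminus] sum.cong refl) (use mult_mat_entry[OF \<Theta> Y] in simp)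
    finally have "t + t = 0" by (simp only: eq_neg_iff_add_eq_0)
    then have "of_nat (Suc 1) * t = 0" by (simp add: mult_2)
    then have "t = 0" by (rule grassmann_torsion_free)
    moreover have "of_even (\<Sum>a<n. (X ^\<^sub>m Suc m) $$ (a, a)) = t"
      unfolding of_even_sum t_def \<Theta>Y[symmetric] by (rule sum.cong[OF refl]) (rule pow, simp_all)
    ultimately show ?thesis
      by (metis of_even_inject zero_even_grassmann.rep_eq)
  qed
  have "((\<Theta> * \<Theta>) ^\<^sub>m (n - 1)) $$ (k, j) = of_even ((X ^\<^sub>m (n - 1)) $$ (k, j))"
    by (rule pow[symmetric, OF jk(2,1)])
  also have "\<dots> = of_even (\<Sum>\<sigma> | \<sigma> permutes {0..<n} \<and> \<sigma> j = k.
      signof \<sigma> * (\<Prod>a\<in>{0..<n} - {j}. - (X $$ (a, \<sigma> a))))"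
    by (subst pow_mat_eq_cofactor_if_traces_vanish[OF X jk even_grassmann_torsion_free traces]) simp_all
  also have "\<dots> = (\<Sum>\<sigma> | \<sigma> permutes {0..<n} \<and> \<sigma> j = k. of_int (sign \<sigma>) *
      prod_list (map (\<lambda>a. - ((\<Theta> * \<Theta>) $$ (a, \<sigma> a))) (all_but n j)))"
    unfolding of_even_sum
  proof (rule sum.cong[OF refl])
    fix \<sigma> assume "\<sigma> \<in> {\<sigma>. \<sigma> permutes {0..<n} \<and> \<sigma> j = k}"
    then have less: "\<sigma> a < n" if "a < n" for a
      using that permutes_in_image[of \<sigma> "{0..<n}" a] by simp
    have "of_even (\<Prod>a\<in>{0..<n} - {j}. - (X $$ (a, \<sigma> a))) =
        prod_list (map of_even (map (\<lambda>a. - (X $$ (a, \<sigma> a))) (all_but n j)))"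
      unfolding all_but_facts(1)[OF jk(1), symmetric]
        prod.distinct_set_conv_list[OF all_but_facts(2)[OF jk(1)]] of_even_prod_list ..
    also have "map of_even (map (\<lambda>a. - (X $$ (a, \<sigma> a))) (all_but n j)) =
        map (\<lambda>a. - ((\<Theta> * \<Theta>) $$ (a, \<sigma> a))) (all_but n j)"
      unfolding map_map comp_def uminus_even_grassmann.rep_eq
      by (rule map_cong[OF refl]) (use all_but_facts(1)[OF jk(1)] less in \<open>simp add: X_entry del: index_mult_mat(1)\<close>)
    finally show "of_even (signof \<sigma> * (\<Prod>a\<in>{0..<n} - {j}. - (X $$ (a, \<sigma> a)))) =
        of_int (sign \<sigma>) * prod_list (map (\<lambda>a. - ((\<Theta> * \<Theta>) $$ (a, \<sigma> a))) (all_but n j))"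
      by (simp only: times_even_grassmann.rep_eq of_even_of_int)
  qed
  finally show ?thesis .
qed

section \<open>The signed number of Eulerian trails\<close>

text \<open>The generator of the edge \<open>e\<close>: the \<open>k\<close>-th generator of the Grassmann algebra stands for the edge
\<open>xs ! k\<close>, and edges outside of \<open>xs\<close> do not contribute to the coefficients of interest.\<close>

definition edge_form :: "(nat \<times> nat) list \<Rightarrow> nat \<times> nat \<Rightarrow> grassmann" where
  "edge_form xs e = linear_form (\<lambda>k. of_bool (xs ! k = e))"

lemma odd_edge_form [simp]: "odd_grassmann (edge_form xs e)"
  by (simp add: edge_form_def)

lemma gcoeff_prod_edge_forms:
  assumes "length es = length xs"
  shows "gcoeff (prod_list (map (edge_form xs) es)) {..<length xs} = matching_det xs es"
proof -
  let ?cs = "map (\<lambda>e k. of_bool (xs ! k = e)) es :: (nat \<Rightarrow> int) list"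
  have "gcoeff (prod_list (map linear_form ?cs)) {..<length xs} =
      det (mat (length xs) (length xs) (\<lambda>(r, k). (?cs ! k) r))"
    by (rule gcoeff_prod_linear_forms_top) (simp add: assms)
  also have "mat (length xs) (length xs) (\<lambda>(r, k). (?cs ! k) r) =
      mat (length xs) (length xs) (\<lambda>(r, k). of_bool (xs ! r = es ! k))"
    by (rule eq_matI) (auto simp: assms)
  also have "map linear_form ?cs = map (edge_form xs) es"
    by (simp add: edge_form_def)
  finally show ?thesis
    by (simp only: matching_det_def)
qed

lemma signed_trails_eq_matrix_power:
  assumes ij: "i < n" "j < n"
  shows "(\<Sum>es\<in>walks n i j (length xs). matching_det xs es) =
    gcoeff (foldr (*) (replicate (length xs) (mat n n (edge_form xs))) (1\<^sub>m n) $$ (i, j)) {..<length xs}"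
proof -
  let ?\<Theta> = "mat n n (edge_form xs)"
  have "foldr (*) (replicate (length xs) ?\<Theta>) (1\<^sub>m n) $$ (i, j) =
      (\<Sum>es\<in>walks n i j (length xs). prod_list (map2 ($$) (replicate (length xs) ?\<Theta>) es))"
    by (subst matrix_product_entry_walks) (use ij in auto)
  also have "\<dots> = (\<Sum>es\<in>walks n i j (length xs). prod_list (map (edge_form xs) es))"
  proof (rule sum.cong[OF refl])
    fix es assume "es \<in> walks n i j (length xs)"
    then have es: "set es \<subseteq> {..<n} \<times> {..<n}" "length es = length xs" by (simp_all add: walks_def)
    have "map2 ($$) (replicate (length xs) ?\<Theta>) es = map (edge_form xs) es"
    proof (rule nth_equalityI)
      fix k assume "k < length (map2 ($$) (replicate (length xs) ?\<Theta>) es)"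
      then have "k < length es" using es by simp
      moreover from this have "es ! k \<in> {..<n} \<times> {..<n}" using es(1) nth_mem by blast
      ultimately show "map2 ($$) (replicate (length xs) ?\<Theta>) es ! k = map (edge_form xs) es ! k"
        using es(2) by (cases "es ! k") simp
    qed (simp add: es)
    then show "prod_list (map2 ($$) (replicate (length xs) ?\<Theta>) es) = prod_list (map (edge_form xs) es)"
      by simp
  qed
  finally show ?thesis
    by (simp add: gcoeff_sum, intro sum.cong refl)
      (simp add: gcoeff_prod_edge_forms walks_def)
qed

text \<open>A function \<open>f\<close> selects one edge out of every vertex \<open>a \<noteq> j\<close>, a function \<open>g\<close> selects one edge into
every vertex \<open>c\<close>. The signs in \<open>out_product\<close> are those of the entries \<open>- 1\<close> of \<open>type_mat\<close>.\<close>

definition out_product :: "nat \<Rightarrow> nat \<Rightarrow> (nat \<times> nat) list \<Rightarrow> (nat \<Rightarrow> nat) \<Rightarrow> grassmann" where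
  "out_product n j xs f = prod_list (map (\<lambda>a. - edge_form xs (a, f a)) (all_but n j))"

definition in_product :: "nat \<Rightarrow> (nat \<times> nat) list \<Rightarrow> (nat \<Rightarrow> nat) \<Rightarrow> grassmann" where
  "in_product n xs g = prod_list (map (\<lambda>c. edge_form xs (g c, c)) [0..<n])"

definition top_coeff :: "(nat \<times> nat) list \<Rightarrow> grassmann \<Rightarrow> int" where
  "top_coeff xs x = gcoeff x {..<length xs}"

lemma top_coeff_sum: "top_coeff xs (sum h I) = (\<Sum>x\<in>I. top_coeff xs (h x))"
  by (simp add: top_coeff_def gcoeff_sum)

lemma top_coeff_of_int_mult: "top_coeff xs (of_int z * x) = z * top_coeff xs x"
  by (simp add: top_coeff_def gcoeff_of_int_mult)

lemma top_coeff_power_minus_one_mult: "top_coeff xs ((- 1) ^ k * x) = (- 1) ^ k * top_coeff xs x"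
  using top_coeff_of_int_mult[of xs "(- 1) ^ k" x] by simp

context
  fixes n i j :: nat and xs :: "(nat \<times> nat) list"
  assumes ij: "i < n" "j < n"
begin

text \<open>The factor for \<open>a \<noteq> j\<close> is the path \<open>a \<rightarrow> f a \<rightarrow> \<sigma> a\<close> of length two. Its first edges are moved to the
front, which costs \<open>(- 1) ^ (n choose 2)\<close>; the edge \<open>i \<rightarrow> \<sigma> j\<close> is moved to position \<open>j\<close> among the second
edges, which costs \<open>(- 1) ^ j\<close>; and sorting these edges by their ends costs the sign of \<open>\<sigma>\<close>. With
\<open>b = f(j := i)\<close>, the edge that ends in \<open>c\<close> then starts in \<open>b (inv \<sigma> c)\<close>.\<close>

lemma rearrange_term:
  assumes \<sigma>: "\<sigma> permutes {0..<n}"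
  shows "edge_form xs (i, \<sigma> j) *
      prod_list (map (\<lambda>a. - edge_form xs (a, f a) * edge_form xs (f a, \<sigma> a)) (all_but n j)) =
    (- 1) ^ ((n choose 2) + j) *
      (of_int (sign \<sigma>) * (out_product n j xs f * in_product n xs ((f(j := i)) \<circ> Hilbert_Choice.inv \<sigma>)))"
proof -
  define b where "b = f(j := i)"
  define z where "z = (\<lambda>a. edge_form xs (b a, \<sigma> a))"
  have n: "Suc (length (all_but n j)) = n" using ij(2) by (simp add: all_but_facts)
  have "edge_form xs (i, \<sigma> j) *
      prod_list (map (\<lambda>a. - edge_form xs (a, f a) * edge_form xs (f a, \<sigma> a)) (all_but n j)) =
      z j * prod_list (map (\<lambda>a. - edge_form xs (a, f a) * z a) (all_but n j))"
    using all_but_facts(1)[OF ij(2)]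
    by (intro arg_cong2[of _ _ _ _ "(*)"] arg_cong[of _ _ prod_list] map_cong) (auto simp: z_def b_def)
  also have "\<dots> = (- 1) ^ (n choose 2) * (out_product n j xs f * (z j * prod_list (map z (all_but n j))))"
    using odd_prod_list_unshuffle[of "z j" "all_but n j" "\<lambda>a. - edge_form xs (a, f a)" z]
    by (simp add: z_def n out_product_def homogeneous_parity_minus)
  also have "z j * prod_list (map z (all_but n j)) = (- 1) ^ j * prod_list (map z [0..<n])"
    by (rule odd_prod_list_move_front) (use ij in \<open>simp_all add: z_def\<close>)
  also have "prod_list (map z [0..<n]) = of_int (sign \<sigma>) * in_product n xs (b \<circ> Hilbert_Choice.inv \<sigma>)"
    using prod_linear_forms_permute[OF \<sigma>, of "\<lambda>c k. of_bool (xs ! k = ((b \<circ> Hilbert_Choice.inv \<sigma>) c, c))"]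
    by (simp add: z_def in_product_def edge_form_def permutes_inverses(2)[OF \<sigma>])
  finally have "edge_form xs (i, \<sigma> j) *
      prod_list (map (\<lambda>a. - edge_form xs (a, f a) * edge_form xs (f a, \<sigma> a)) (all_but n j)) =
      (- 1) ^ (n choose 2) * (out_product n j xs f * ((- 1) ^ j * (of_int (sign \<sigma>) * in_product n xs (b \<circ> Hilbert_Choice.inv \<sigma>))))" .
  also have "out_product n j xs f * ((- 1) ^ j * (of_int (sign \<sigma>) * in_product n xs (b \<circ> Hilbert_Choice.inv \<sigma>))) =
      (- 1) ^ j * (of_int (sign \<sigma>) * (out_product n j xs f * in_product n xs (b \<circ> Hilbert_Choice.inv \<sigma>)))"
    by (simp add: minus_one_power_iff sign_def)
  finally show ?thesis
    by (simp add: b_def power_add mult.assoc)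
qed

text \<open>The two signs of \<open>\<sigma>\<close>, from the cofactor formula and from \<open>rearrange_term\<close>, cancel.\<close>

lemma matrix_power_expansion:
  "top_coeff xs ((mat n n (edge_form xs) * (mat n n (edge_form xs) * mat n n (edge_form xs)) ^\<^sub>m (n - 1)) $$ (i, j)) =
    (- 1) ^ ((n choose 2) + j) * (\<Sum>f\<in>({0..<n} - {j}) \<rightarrow>\<^sub>E {..<n}. \<Sum>\<sigma> | \<sigma> permutes {0..<n}.
      top_coeff xs (out_product n j xs f * in_product n xs ((f(j := i)) \<circ> Hilbert_Choice.inv \<sigma>)))"
proof -
  let ?\<Theta> = "mat n n (edge_form xs)"
  define S where "S = {\<sigma>. \<sigma> permutes {0..<n}}"
  define F where "F = ({0..<n} - {j}) \<rightarrow>\<^sub>E {..<n}"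
  define summand where "summand = (\<lambda>\<sigma>. edge_form xs (i, \<sigma> j) *
    prod_list (map (\<lambda>a. - ((?\<Theta> * ?\<Theta>) $$ (a, \<sigma> a))) (all_but n j)))"
  have \<Theta>: "?\<Theta> \<in> carrier_mat n n" by simp
  have sq: "?\<Theta> * ?\<Theta> \<in> carrier_mat n n" by (rule mult_carrier_mat[OF \<Theta> \<Theta>])
  have fin: "finite S" by (simp add: S_def finite_permutations)
  have less: "\<sigma> a < n" if "\<sigma> \<in> S" "a < n" for \<sigma> a
    using that permutes_in_image[of \<sigma> "{0..<n}" a] by (simp add: S_def)
  have "(?\<Theta> * (?\<Theta> * ?\<Theta>) ^\<^sub>m (n - 1)) $$ (i, j) =
      (\<Sum>k<n. edge_form xs (i, k) * ((?\<Theta> * ?\<Theta>) ^\<^sub>m (n - 1)) $$ (k, j))"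
    unfolding mult_mat_entry[OF \<Theta> pow_carrier_mat[OF sq] ij]
    by (rule sum.cong[OF refl]) (use ij in simp)
  also have "\<dots> = (\<Sum>k<n. \<Sum>\<sigma> | \<sigma> \<in> S \<and> \<sigma> j = k. of_int (sign \<sigma>) * summand \<sigma>)"
  proof (rule sum.cong[OF refl])
    fix k assume "k \<in> {..<n}"
    then have k: "k < n" by simp
    have "((?\<Theta> * ?\<Theta>) ^\<^sub>m (n - 1)) $$ (k, j) = (\<Sum>\<sigma> | \<sigma> \<in> S \<and> \<sigma> j = k. of_int (sign \<sigma>) *
        prod_list (map (\<lambda>a. - ((?\<Theta> * ?\<Theta>) $$ (a, \<sigma> a))) (all_but n j)))"
      unfolding S_def mem_Collect_eq
      by (rule odd_matrix_even_power_cofactor[OF \<Theta> _ ij(2) k]) simp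
    then show "edge_form xs (i, k) * ((?\<Theta> * ?\<Theta>) ^\<^sub>m (n - 1)) $$ (k, j) =
        (\<Sum>\<sigma> | \<sigma> \<in> S \<and> \<sigma> j = k. of_int (sign \<sigma>) * summand \<sigma>)"
      unfolding summand_def
      by (simp only: sum_distrib_left mult_of_int_left_commute)
        (rule sum.cong, auto)
  qed
  also have "\<dots> = (\<Sum>\<sigma>\<in>S. of_int (sign \<sigma>) * summand \<sigma>)"
    by (rule sum.group[OF fin]) (use less ij in auto)
  also have "\<dots> = (\<Sum>\<sigma>\<in>S. \<Sum>f\<in>F. (- 1) ^ ((n choose 2) + j) *
      (out_product n j xs f * in_product n xs ((f(j := i)) \<circ> Hilbert_Choice.inv \<sigma>)))"
  proof (rule sum.cong[OF refl])
    fix \<sigma> assume \<sigma>: "\<sigma> \<in> S"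
    have "prod_list (map (\<lambda>a. - ((?\<Theta> * ?\<Theta>) $$ (a, \<sigma> a))) (all_but n j)) =
        prod_list (map (\<lambda>a. \<Sum>b<n. - edge_form xs (a, b) * edge_form xs (b, \<sigma> a)) (all_but n j))"
    proof (intro arg_cong[of _ _ prod_list] map_cong refl)
      fix a assume "a \<in> set (all_but n j)"
      then have a: "a < n" using all_but_facts(1)[OF ij(2)] by auto
      show "- ((?\<Theta> * ?\<Theta>) $$ (a, \<sigma> a)) = (\<Sum>b<n. - edge_form xs (a, b) * edge_form xs (b, \<sigma> a))"
        unfolding mult_mat_entry[OF \<Theta> \<Theta> a less[OF \<sigma> a]] sum_negf[symmetric]
        by (rule sum.cong[OF refl]) (use a less[OF \<sigma> a] in simp)
    qed
    also have "\<dots> = (\<Sum>f\<in>F. prod_list (map (\<lambda>a. - edge_form xs (a, f a) * edge_form xs (f a, \<sigma> a)) (all_but n j)))"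
      unfolding F_def all_but_facts(1)[OF ij(2), symmetric]
      by (rule prod_list_sum_distrib) (use all_but_facts(2)[OF ij(2)] in auto)
    finally have "of_int (sign \<sigma>) * summand \<sigma> = (\<Sum>f\<in>F. of_int (sign \<sigma>) * (edge_form xs (i, \<sigma> j) *
        prod_list (map (\<lambda>a. - edge_form xs (a, f a) * edge_form xs (f a, \<sigma> a)) (all_but n j))))"
      unfolding summand_def by (simp only: sum_distrib_left)
    also have "\<dots> = (\<Sum>f\<in>F. (- 1) ^ ((n choose 2) + j) *
        (out_product n j xs f * in_product n xs ((f(j := i)) \<circ> Hilbert_Choice.inv \<sigma>)))"
      using \<sigma> by (intro sum.cong refl, subst rearrange_term) (auto simp: S_def sign_def)
    finally show "of_int (sign \<sigma>) * summand \<sigma> = (\<Sum>f\<in>F. (- 1) ^ ((n choose 2) + j) *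
        (out_product n j xs f * in_product n xs ((f(j := i)) \<circ> Hilbert_Choice.inv \<sigma>)))" .
  qed
  also have "\<dots> = (\<Sum>f\<in>F. \<Sum>\<sigma>\<in>S. (- 1) ^ ((n choose 2) + j) *
      (out_product n j xs f * in_product n xs ((f(j := i)) \<circ> Hilbert_Choice.inv \<sigma>)))"
    by (rule sum.swap)
  finally show ?thesis
    by (simp only: top_coeff_sum top_coeff_power_minus_one_mult sum_distrib_left F_def S_def)
qed

text \<open>A nonzero coefficient means that the selected edges are exactly those of \<open>xs\<close>. Counting the edges
by their start and by their end determines the fibres of \<open>g\<close> and of \<open>f\<close>.\<close>

lemma top_coeff_nonzero_degrees:
  assumes nonzero: "top_coeff xs (out_product n j xs f * in_product n xs g) \<noteq> 0" and len: "length xs = 2 * n - 1"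
  shows "length (filter (\<lambda>e. fst e = r) xs) = of_bool (r < n \<and> r \<noteq> j) + card {c. c < n \<and> g c = r}"
    and "length (filter (\<lambda>e. snd e = r) xs) = card {a. a < n \<and> a \<noteq> j \<and> f a = r} + of_bool (r < n)"
proof -
  define es where "es = map (\<lambda>a. (a, f a)) (all_but n j) @ map (\<lambda>c. (g c, c)) [0..<n]"
  have neg: "prod_list (map (\<lambda>a. - h a) as) = (- 1) ^ length as * prod_list (map h as)"
    for h :: "nat \<Rightarrow> grassmann" and as
    by (induction as) (simp_all add: minus_one_power_iff)
  have es_len: "length es = length xs"
    using ij(2) len by (simp add: es_def all_but_facts)
  have "out_product n j xs f * in_product n xs g = (- 1) ^ (n - 1) * prod_list (map (edge_form xs) es)"
    unfolding out_product_def in_product_def neg es_def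
    using ij(2) by (simp add: all_but_facts comp_def mult.assoc)
  then have "gcoeff (prod_list (map (edge_form xs) es)) {..<length xs} \<noteq> 0"
    using nonzero by (auto simp: top_coeff_power_minus_one_mult top_coeff_def[symmetric])
  then have "mset es = mset xs"
    using es_len by (intro mset_eq_if_matching_det_nonzero) (simp_all add: gcoeff_prod_edge_forms)
  then have filter_eq: "length (filter P xs) = length (filter P es)" for P
    by (metis mset_filter size_mset)
  have all: "length (filter P (all_but n j)) = card {a. a < n \<and> a \<noteq> j \<and> P a}" for P
    using distinct_length_filter[OF all_but_facts(2)[OF ij(2)], of P] all_but_facts(1)[OF ij(2)]
    by (simp add: Int_def conj_ac)
  have upt: "length (filter P [0..<n]) = card {c. c < n \<and> P c}" for P
    using distinct_length_filter[of "[0..<n]" P] by (simp add: Int_def conj_ac)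
  have "{a. a < n \<and> a \<noteq> j \<and> a = r} = (if r < n \<and> r \<noteq> j then {r} else {})"
    and "{c. c < n \<and> c = r} = (if r < n then {r} else {})" by auto
  then have single: "length (filter (\<lambda>a. a = r) (all_but n j)) = of_bool (r < n \<and> r \<noteq> j)"
    "length (filter (\<lambda>c. c = r) [0..<n]) = of_bool (r < n)"
    unfolding all upt by (simp_all only: if_distrib[of card], simp_all)
  show "length (filter (\<lambda>e. fst e = r) xs) = of_bool (r < n \<and> r \<noteq> j) + card {c. c < n \<and> g c = r}"
    unfolding filter_eq es_def by (simp add: filter_map comp_def single upt)
  show "length (filter (\<lambda>e. snd e = r) xs) = card {a. a < n \<and> a \<noteq> j \<and> f a = r} + of_bool (r < n)"
    unfolding filter_eq es_def by (simp add: filter_map comp_def single all)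
qed

text \<open>The summand depends on \<open>\<sigma>\<close> only through \<open>g = b \<circ> inv \<sigma>\<close>, where \<open>b = f(j := i)\<close>. For every \<open>g\<close> with a nonzero
summand the degree condition forces \<open>b\<close> and \<open>g\<close> to have fibres of the same size
\<open>p\<^sub>r + \<delta>\<^sub>j\<^sub>r - 1\<close> over every \<open>r\<close>, so by \<open>card_permutations_matching\<close> the number of permutations that yield
\<open>g\<close> is the product of the factorials, whatever \<open>f\<close> and \<open>g\<close> are.\<close>

lemma sum_over_permutations:
  assumes len: "length xs = 2 * n - 1"
    and degrees: "\<And>r. r < n \<Longrightarrow> length (filter (\<lambda>e. fst e = r) xs) + of_bool (r = j) =
      length (filter (\<lambda>e. snd e = r) xs) + of_bool (r = i)"
    and f: "f \<in> ({0..<n} - {j}) \<rightarrow>\<^sub>E {..<n}"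
  shows "(\<Sum>\<sigma> | \<sigma> permutes {0..<n}. top_coeff xs (out_product n j xs f * in_product n xs ((f(j := i)) \<circ> Hilbert_Choice.inv \<sigma>))) =
    (\<Prod>r<n. fact (length (filter (\<lambda>e. fst e = r) xs) + of_bool (r = j) - 1)) *
    (\<Sum>g\<in>{0..<n} \<rightarrow>\<^sub>E {..<n}. top_coeff xs (out_product n j xs f * in_product n xs g))"
proof -
  define b where "b = f(j := i)"
  define S where "S = {\<sigma>. \<sigma> permutes {0..<n}}"
  define G where "G = {0..<n} \<rightarrow>\<^sub>E {..<n}"
  define W :: int where
    "W = (\<Prod>r<n. fact (length (filter (\<lambda>e. fst e = r) xs) + of_bool (r = j) - 1))"
  have b_less: "b a < n" if "a < n" for a
    using f ij that by (auto simp: b_def PiE_def Pi_def)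
  have inv_less: "Hilbert_Choice.inv \<sigma> c < n" if "\<sigma> \<in> S" "c < n" for \<sigma> c
    using that permutes_in_image[OF permutes_inv, of \<sigma> "{0..<n}" c] by (simp add: S_def)
  have fin: "finite S" by (simp add: S_def finite_permutations)
  have restrict: "in_product n xs (restrict h {0..<n}) = in_product n xs h" for h
    unfolding in_product_def by (intro arg_cong[of _ _ prod_list] map_cong) auto
  have "(\<Sum>\<sigma>\<in>S. top_coeff xs (out_product n j xs f * in_product n xs (b \<circ> Hilbert_Choice.inv \<sigma>))) =
      (\<Sum>\<sigma>\<in>S. top_coeff xs (out_product n j xs f * in_product n xs (restrict (b \<circ> Hilbert_Choice.inv \<sigma>) {0..<n})))"
    by (simp only: restrict)
  also have "\<dots> = (\<Sum>g\<in>G. \<Sum>\<sigma> | \<sigma> \<in> S \<and> restrict (b \<circ> Hilbert_Choice.inv \<sigma>) {0..<n} = g.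
      top_coeff xs (out_product n j xs f * in_product n xs (restrict (b \<circ> Hilbert_Choice.inv \<sigma>) {0..<n})))"
    by (rule sum.group[symmetric, OF fin])
      (auto simp: G_def b_less inv_less intro!: finite_PiE)
  also have "\<dots> = (\<Sum>g\<in>G. int (card {\<sigma> \<in> S. restrict (b \<circ> Hilbert_Choice.inv \<sigma>) {0..<n} = g}) *
      top_coeff xs (out_product n j xs f * in_product n xs g))"
    by (rule sum.cong[OF refl]) simp
  also have "\<dots> = (\<Sum>g\<in>G. W * top_coeff xs (out_product n j xs f * in_product n xs g))"
  proof (rule sum.cong[OF refl])
    fix g assume g: "g \<in> G"
    show "int (card {\<sigma> \<in> S. restrict (b \<circ> Hilbert_Choice.inv \<sigma>) {0..<n} = g}) * top_coeff xs (out_product n j xs f * in_product n xs g) =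
        W * top_coeff xs (out_product n j xs f * in_product n xs g)"
    proof (cases "top_coeff xs (out_product n j xs f * in_product n xs g) = 0")
      case False
      note deg = top_coeff_nonzero_degrees[OF False len]
      have card_b: "card {a. a < n \<and> b a = r} = card {a. a < n \<and> a \<noteq> j \<and> f a = r} + of_bool (r = i)" for r
      proof -
        have "{a. a < n \<and> b a = r} = {a. a < n \<and> a \<noteq> j \<and> f a = r} \<union> (if r = i then {j} else {})"
          using ij by (auto simp: b_def)
        then show ?thesis
          by (simp add: card_insert_if)
      qed
      have fibre: "card {a. a < n \<and> b a = r} = length (filter (\<lambda>e. fst e = r) xs) + of_bool (r = j) - 1"
        "card {a. a < n \<and> b a = r} = card {a. a < n \<and> g a = r}" if "r < n" for r
        using deg[of r] degrees[OF that] card_b[of r] that by (auto simp: of_bool_def split: if_splits)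
      have fibre_eq: "card {a. a < n \<and> b a = r} = card {a. a < n \<and> g a = r}" for r
      proof (cases "r < n")
        case False
        then have "{a. a < n \<and> b a = r} = {}" "{a. a < n \<and> g a = r} = {}"
          using b_less g by (auto simp: G_def)
        then show ?thesis by (simp only:)
      qed (rule fibre(2))
      have "{\<sigma> \<in> S. restrict (b \<circ> Hilbert_Choice.inv \<sigma>) {0..<n} = g} = {\<sigma>. \<sigma> permutes {0..<n} \<and> (\<forall>a<n. g (\<sigma> a) = b a)}"
      proof (intro Collect_cong conj_cong)
        fix \<sigma>
        show "\<sigma> \<in> S \<longleftrightarrow> \<sigma> permutes {0..<n}" by (simp add: S_def)
        assume \<sigma>: "\<sigma> permutes {0..<n}"
        have less: "\<sigma> a < n \<longleftrightarrow> a < n" "Hilbert_Choice.inv \<sigma> a < n \<longleftrightarrow> a < n" for a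
          using permutes_in_image[OF \<sigma>, of a] permutes_in_image[OF permutes_inv[OF \<sigma>], of a] by simp_all
        show "restrict (b \<circ> Hilbert_Choice.inv \<sigma>) {0..<n} = g \<longleftrightarrow> (\<forall>a<n. g (\<sigma> a) = b a)"
        proof
          assume "restrict (b \<circ> Hilbert_Choice.inv \<sigma>) {0..<n} = g"
          then show "\<forall>a<n. g (\<sigma> a) = b a"
            using less permutes_inverses[OF \<sigma>] by auto
        next
          assume *: "\<forall>a<n. g (\<sigma> a) = b a"
          show "restrict (b \<circ> Hilbert_Choice.inv \<sigma>) {0..<n} = g"
          proof (rule ext)
            fix c
            show "restrict (b \<circ> Hilbert_Choice.inv \<sigma>) {0..<n} c = g c"
            proof (cases "c < n")
              case True
              then have "g (\<sigma> (Hilbert_Choice.inv \<sigma> c)) = b (Hilbert_Choice.inv \<sigma> c)" using * less by simp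
              then show ?thesis using True permutes_inverses[OF \<sigma>] by simp
            qed (use g in \<open>auto simp: G_def PiE_def extensional_def\<close>)
          qed
        qed
      qed
      then have "card {\<sigma> \<in> S. restrict (b \<circ> Hilbert_Choice.inv \<sigma>) {0..<n} = g} = (\<Prod>r<n. fact (card {a. a < n \<and> b a = r}))"
        using card_permutations_matching[OF fibre_eq b_less] by simp
      also have "\<dots> = (\<Prod>r<n. fact (length (filter (\<lambda>e. fst e = r) xs) + of_bool (r = j) - 1))"
        by (rule prod.cong) (simp_all add: fibre(1))
      finally show ?thesis by (simp add: W_def)
    qed simp
  qed
  finally show ?thesis
    by (simp add: b_def S_def G_def W_def sum_distrib_left)
qed

text \<open>Summed over all selections, the products become products of the sums of all edges out of \<open>a\<close>,
with sign, and of all edges into \<open>c\<close>. These linear forms are the columns of \<open>type_mat\<close>, so the top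
coefficient of their product is the determinant.\<close>

lemma sum_of_products_eq_det:
  assumes len: "length xs = 2 * n - 1" and xs: "set xs \<subseteq> {..<n} \<times> {..<n}"
  shows "(\<Sum>f\<in>({0..<n} - {j}) \<rightarrow>\<^sub>E {..<n}. \<Sum>g\<in>{0..<n} \<rightarrow>\<^sub>E {..<n}.
      top_coeff xs (out_product n j xs f * in_product n xs g)) = det (type_mat_del n xs j)"
proof -
  define row where "row = (\<lambda>a k. - (\<Sum>b<n. of_bool (xs ! k = (a, b))) :: int)"
  define col where "col = (\<lambda>c k. (\<Sum>b<n. of_bool (xs ! k = (b, c))) :: int)"
  let ?cs = "map row (all_but n j) @ map col [0..<n]"
  have "(\<Sum>f\<in>({0..<n} - {j}) \<rightarrow>\<^sub>E {..<n}. out_product n j xs f) = prod_list (map linear_form (map row (all_but n j)))"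
    unfolding out_product_def all_but_facts(1)[OF ij(2), symmetric]
    by (subst prod_list_sum_distrib[symmetric])
      (use all_but_facts(2)[OF ij(2)] in \<open>simp_all add: comp_def row_def edge_form_def linear_form_uminus linear_form_sum sum_negf\<close>)
  moreover have "(\<Sum>g\<in>{0..<n} \<rightarrow>\<^sub>E {..<n}. in_product n xs g) = prod_list (map linear_form (map col [0..<n]))"
    using prod_list_sum_distrib[of "[0..<n]" "{..<n}" "\<lambda>c b. edge_form xs (b, c)"]
    by (simp add: in_product_def comp_def col_def edge_form_def linear_form_sum)
  ultimately have "(\<Sum>f\<in>({0..<n} - {j}) \<rightarrow>\<^sub>E {..<n}. \<Sum>g\<in>{0..<n} \<rightarrow>\<^sub>E {..<n}.
      top_coeff xs (out_product n j xs f * in_product n xs g)) = top_coeff xs (prod_list (map linear_form ?cs))"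
    by (simp add: top_coeff_sum[symmetric] sum_product[symmetric])
  also have "\<dots> = det (mat (2 * n - 1) (2 * n - 1) (\<lambda>(r, k). (?cs ! k) r))"
    unfolding top_coeff_def len
    by (rule gcoeff_prod_linear_forms_top) (use ij(2) in \<open>simp add: all_but_facts\<close>)
  also have "mat (2 * n - 1) (2 * n - 1) (\<lambda>(r, k). (?cs ! k) r) = type_mat_del n xs j"
    unfolding type_mat_del_eq[of j n, OF less_le_trans[OF ij(2)], simplified]
  proof (rule eq_matI)
    fix r k
    let ?M = "mat (2 * n - Suc 0) (2 * n - Suc 0) (\<lambda>(k, c). type_mat n xs $$ (k, if c < j then c else Suc c))"
    assume "r < dim_row ?M" "k < dim_col ?M"
    then have rk: "r < 2 * n - 1" "k < 2 * n - 1" by simp_all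
    obtain a b where ab: "xs ! r = (a, b)" by (cases "xs ! r")
    have "xs ! r \<in> set xs" using rk len by simp
    then have less: "a < n" "b < n" using xs ab by auto
    have row: "row c r = (if c = a then - 1 else 0)" for c
      using less by (simp add: row_def ab)
    have col: "col c r = (if c = b then 1 else 0)" for c
      using less by (simp add: col_def ab)
    show "mat (2 * n - 1) (2 * n - 1) (\<lambda>(r, k). (?cs ! k) r) $$ (r, k) = ?M $$ (r, k)"
    proof (cases "k < n - 1")
      case True
      then show ?thesis
        using rk ij(2) less all_but_facts(3,4)[OF ij(2)]
        by (auto simp: nth_append row type_mat_def ab)
    next
      case False
      then show ?thesis
        using rk ij(2) less all_but_facts(3)[OF ij(2)]
        by (auto simp: nth_append col type_mat_def ab)
    qed
  qed simp_all
  finally show ?thesis .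
qed

end

lemma signed_trail_count:
  assumes ij: "i < n" "j < n" and len: "length xs = 2 * n - 1" and xs: "set xs \<subseteq> {..<n} \<times> {..<n}"
    and degrees: "\<And>r. r < n \<Longrightarrow> length (filter (\<lambda>e. fst e = r) xs) + of_bool (r = j) =
      length (filter (\<lambda>e. snd e = r) xs) + of_bool (r = i)"
  shows "(\<Sum>es\<in>walks n i j (2 * n - 1). matching_det xs es) =
    (- 1) ^ ((n choose 2) + j) * det (type_mat_del n xs j) *
    (\<Prod>r<n. fact (length (filter (\<lambda>e. fst e = r) xs) + of_bool (r = j) - 1))"
proof -
  let ?\<Theta> = "mat n n (edge_form xs)"
  have "(\<Sum>es\<in>walks n i j (2 * n - 1). matching_det xs es) =
      top_coeff xs (foldr (*) (replicate (Suc (2 * (n - 1))) ?\<Theta>) (1\<^sub>m n) $$ (i, j))"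
  proof -
    have "length xs = Suc (2 * (n - 1))" using len ij by simp
    then show ?thesis
      using signed_trails_eq_matrix_power[OF ij, of xs] len top_coeff_def[of xs] by simp
  qed
  also have "\<dots> = top_coeff xs ((?\<Theta> * (?\<Theta> * ?\<Theta>) ^\<^sub>m (n - 1)) $$ (i, j))"
    by (subst foldr_replicate_odd) simp_all
  also have "\<dots> = (- 1) ^ ((n choose 2) + j) * (\<Sum>f\<in>({0..<n} - {j}) \<rightarrow>\<^sub>E {..<n}.
      (\<Prod>r<n. fact (length (filter (\<lambda>e. fst e = r) xs) + of_bool (r = j) - 1)) *
      (\<Sum>g\<in>{0..<n} \<rightarrow>\<^sub>E {..<n}. top_coeff xs (out_product n j xs f * in_product n xs g)))"
    unfolding matrix_power_expansion[OF ij] by (simp only: sum_over_permutations[OF ij len degrees] cong: sum.cong)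
  also have "\<dots> = (- 1) ^ ((n choose 2) + j) *
      ((\<Prod>r<n. fact (length (filter (\<lambda>e. fst e = r) xs) + of_bool (r = j) - 1)) *
      det (type_mat_del n xs j))"
    by (simp only: sum_distrib_left[symmetric] sum_of_products_eq_det[OF ij len xs])
  finally show ?thesis by (simp only: mult_ac)
qed

section \<open>The antisymmetrisation formula\<close>

theorem theorem84:
  fixes n :: nat
    and A :: "nat \<Rightarrow> 'a :: comm_ring_1 mat"
    and ord :: "(nat \<times> nat) set \<Rightarrow> (nat \<times> nat) list"
    and i j s :: nat
  assumes "n \<ge> 1"
    and "\<And>r. r < 2 * n - 1 \<Longrightarrow> A r \<in> carrier_mat n n"
    and "\<And>\<nu>. is_type n \<nu> \<Longrightarrow> distinct (ord \<nu>) \<and> set (ord \<nu>) = \<nu>"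
    and "i < n" and "j < n" and "s < 2 * n"
  shows "antisymmetrisation n (2 * n - 1) A $$ (i, j) =
    (- 1) ^ ((n choose 2) + s) *
    (\<Sum>\<nu> | is_type n \<nu> \<and> weight_p n \<nu> - weight_q n \<nu> = unit_vec n i - unit_vec n j.
       of_int (det (type_mat_del n (ord \<nu>) s)) *
       of_int (\<Prod>r<n. fact_int (weight_p n \<nu> $ r + (if j = r then 1 else 0) - 1)) *
       det (entry_mat n A (ord \<nu>)))"
proof -
  \<comment> \<open>Up to a sign the determinant does not depend on the deleted column, so the count for column \<open>j\<close>
    serves for all \<open>s\<close>.\<close>
  have coefficient: "(\<Sum>es\<in>walks n i j (2 * n - 1). matching_det (ord \<nu>) es) =
      (- 1) ^ ((n choose 2) + s) * (det (type_mat_del n (ord \<nu>) s) *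
      (\<Prod>r<n. fact_int (weight_p n \<nu> $ r + (if j = r then 1 else 0) - 1)))"
    if type: "is_type n \<nu>"
      and weights: "weight_p n \<nu> - weight_q n \<nu> = (unit_vec n i - unit_vec n j :: int vec)" for \<nu>
  proof -
    let ?xs = "ord \<nu>"
    have ord: "distinct ?xs" "set ?xs = \<nu>" using assms(3)[OF type] by auto
    have len: "length ?xs = 2 * n - 1" and edges: "set ?xs \<subseteq> {..<n} \<times> {..<n}"
      using ord type distinct_card[OF ord(1)] by (auto simp: is_type_def)
    have p: "weight_p n \<nu> $ r = int (length (filter (\<lambda>e. fst e = r) ?xs))"
      and q: "weight_q n \<nu> $ r = int (length (filter (\<lambda>e. snd e = r) ?xs))" if "r < n" for r
      using that ord
      by (simp_all add: weight_p_def weight_q_def length_filter_fst_eq_card length_filter_snd_eq_card)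
    have degrees: "length (filter (\<lambda>e. fst e = r) ?xs) + of_bool (r = j) =
        length (filter (\<lambda>e. snd e = r) ?xs) + of_bool (r = i)" if "r < n" for r
    proof -
      have "(weight_p n \<nu> - weight_q n \<nu>) $ r = weight_p n \<nu> $ r - weight_q n \<nu> $ r"
        using that by (simp add: weight_p_def weight_q_def)
      then have "weight_p n \<nu> $ r - weight_q n \<nu> $ r = of_bool (r = i) - of_bool (r = j)"
        unfolding weights using that by (auto simp: unit_vec_def)
      then show ?thesis
        using p[OF that] q[OF that] by (auto simp: of_bool_def split: if_splits)
    qed
    \<comment> \<open>For a vertex without outgoing edges other than \<open>j\<close>, both the truncated subtraction and the
      convention for factorials of negative numbers give \<open>1\<close>.\<close>
    have "fact_int (weight_p n \<nu> $ r + (if j = r then 1 else 0) - 1) =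
        fact (length (filter (\<lambda>e. fst e = r) ?xs) + of_bool (r = j) - 1)" if "r < n" for r
      unfolding p[OF that] fact_int_def
      by (auto simp: of_bool_def nat_diff_distrib nat_add_distrib)
    then have facts: "(\<Prod>r<n. fact_int (weight_p n \<nu> $ r + (if j = r then 1 else 0) - 1)) =
        (\<Prod>r<n. fact (length (filter (\<lambda>e. fst e = r) ?xs) + of_bool (r = j) - 1))"
      by (intro prod.cong) auto
    have "(- 1) ^ j * det (type_mat_del n ?xs j) = (- 1) ^ s * det (type_mat_del n ?xs s)"
      by (rule det_type_mat_del_independent) (use len edges assms in auto)
    then show ?thesis
      unfolding facts
      using signed_trail_count[OF assms(4,5) len edges degrees] by (simp add: power_add mult_ac)
  qed
  have "antisymmetrisation n (2 * n - 1) A $$ (i, j) =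
    (\<Sum>\<nu> | is_type n \<nu> \<and> weight_p n \<nu> - weight_q n \<nu> = unit_vec n i - unit_vec n j.
       of_int (\<Sum>es\<in>walks n i j (2 * n - 1). matching_det (ord \<nu>) es) * det (entry_mat n A (ord \<nu>)))"
    by (rule antisymmetrisation_entry_types) (use assms in auto)
  also have "\<dots> = (\<Sum>\<nu> | is_type n \<nu> \<and> weight_p n \<nu> - weight_q n \<nu> = unit_vec n i - unit_vec n j.
       (- 1) ^ ((n choose 2) + s) * (of_int (det (type_mat_del n (ord \<nu>) s)) *
       of_int (\<Prod>r<n. fact_int (weight_p n \<nu> $ r + (if j = r then 1 else 0) - 1)) *
       det (entry_mat n A (ord \<nu>))))"
  proof (rule sum.cong[OF refl])
    fix \<nu> assume "\<nu> \<in> {\<nu>. is_type n \<nu> \<and> weight_p n \<nu> - weight_q n \<nu> = unit_vec n i - unit_vec n j}"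
    then have "is_type n \<nu>" "weight_p n \<nu> - weight_q n \<nu> = unit_vec n i - unit_vec n j" by simp_all
    note coefficient = coefficient[OF this]
    show "of_int (\<Sum>es\<in>walks n i j (2 * n - 1). matching_det (ord \<nu>) es) * det (entry_mat n A (ord \<nu>)) =
       (- 1) ^ ((n choose 2) + s) * (of_int (det (type_mat_del n (ord \<nu>) s)) *
       of_int (\<Prod>r<n. fact_int (weight_p n \<nu> $ r + (if j = r then 1 else 0) - 1)) *
       det (entry_mat n A (ord \<nu>)))"
      unfolding coefficient by (simp only: of_int_mult of_int_power of_int_minus of_int_1 mult.assoc)
  qed
  finally show ?thesis by (simp add: sum_distrib_left)
qed

end
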